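(* Let $K$ be a pure cubical complex of dimension $d$ and let $K'$ be a cubical subdivision of $K$. Then $$h^{(sc)}(K',x)\;=\;\sum_{F\in\mathcal F(K)}\ell_F(K'_F,x)\,h(\mathrm{link}_K(F),x),$$ where $\ell_F(K'_F,x)=\sum_{G\in\mathcal F(K),\,G\le F}(-1)^{\dim F-\dim G}h^{(sc)}(K'_G,x)$ and $h(\mathrm{link}_K(F),x)=\sum_{G\in K,\,G\ge F}x^{\dim G-\dim F}(1-x)^{d-\dim G}$.
   Context: A $d$-dimensional (abstract) cube is a poset isomorphic to the poset of all faces (including the empty face) of $[0,1]^d$. A cubical complex is a finite poset $K$ with a minimum element $\varnothing$ (the empty face) such that every interval $[\varnothing,F]$ is a cube and any two elements have a greatest lower bound; elements are faces, $\dim F$ is the dimension of the cube $[\varnothing,F]$, $\dim K$ is the maximum face dimension, $K$ is pure if all maximal faces have the same dimension, $\mathcal F(K)$ is the set of nonempty faces, subcomplexes are nonempty order ideals, and topological properties refer to the order complex of $\mathcal F(K)$. A face $F$ is regarded as the cubical complex $[\varnothing,F]$. A cubical subdivision of a cubical complex $K$ is a cubical complex $K'$ with a map $\sigma:\mathcal F(K')\to\mathcal F(K)$ such that for every $F\in\mathcal F(K)$: (a) $K'_F:=\sigma^{-1}(\{G\in\mathcal F(K):G\le F\})\cup\{\varnothing\}$ is a subcomplex of $K'$ homeomorphic to a ball of dimension $\dim F$; (b) $\sigma^{-1}(F)$ is the set of interior faces of this ball. $K'_F$ is the restriction of $K'$ to $F$. Short cubical $h$-polynomial of a cubical complex $L$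 of dimension $k$: $h^{(sc)}(L,x)=\sum_{E\in L\setminus\{\varnothing\}}(2x)^{\dim E}(1-x)^{k-\dim E}$ (so $h^{(sc)}(K'_G,x)$ uses $k=\dim G$). The link $\mathrm{link}_K(F)$ of a nonempty face $F$ is the simplicial complex whose face poset is the poset of faces $G\ge F$ of $K$, a face $G$ corresponding to a simplex with $\dim G-\dim F$ vertices; the displayed formula is its $h$-polynomial (as a complex of dimension $d-\dim F-1$). *)

theory Defs
  imports
    "HOL-Analysis.Analysis"
    "HOL-Analysis.Finite_Function_Topology"
    "HOL-Computational_Algebra.Polynomial"
begin

text \<open>
  A poset is a reflexive relation \<open>r :: 'a rel\<close> satisfying \<^term>\<open>Partial_order r\<close>; its elements
  are \<^term>\<open>Field r\<close>, and \<open>(a, b) \<in> r\<close> means \<open>a \<le> b\<close>. The subposet on \<open>A\<close> is \<open>Restr r A\<close>.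
\<close>

subsection \<open>Cubes\<close>

text \<open>
  The unit cube of dimension \<open>d\<close>, with \<open>d\<close> a term-level parameter, lives in the real vector space
  of finitely supported functions on \<^typ>\<open>nat\<close>, so that the library's \<^const>\<open>face_of\<close> applies.
\<close>

definition unit_cube :: "nat \<Rightarrow> (nat \<Rightarrow>\<^sub>0 real) set" where
  "unit_cube d = {p. (\<forall>i<d. 0 \<le> Poly_Mapping.lookup p i \<and> Poly_Mapping.lookup p i \<le> 1) \<and>
                     (\<forall>i\<ge>d. Poly_Mapping.lookup p i = 0)}"

definition cube_face_poset :: "nat \<Rightarrow> (nat \<Rightarrow>\<^sub>0 real) set rel" where
  "cube_face_poset d = {(A, B). A face_of unit_cube d \<and> B face_of unit_cube d \<and> A \<subseteq> B}"

text \<open>For posets, \<^const>\<open>iso\<close> is order isomorphism; see \<open>iso_iff2\<close>.\<close>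

definition abstract_cube :: "nat \<Rightarrow> 'a rel \<Rightarrow> bool" where
  "abstract_cube d r \<longleftrightarrow> Partial_order r \<and> (\<exists>f. iso r (cube_face_poset d) f)"

subsection \<open>Cubical complexes\<close>

definition is_minimum :: "'a rel \<Rightarrow> 'a \<Rightarrow> bool" where
  "is_minimum r b \<longleftrightarrow> b \<in> Field r \<and> (\<forall>a\<in>Field r. (b, a) \<in> r)"

definition empty_face :: "'a rel \<Rightarrow> 'a" where
  "empty_face K = (THE b. is_minimum K b)"

definition faces :: "'a rel \<Rightarrow> 'a set" where
  "faces K = Field K - {empty_face K}"

definition is_glb :: "'a rel \<Rightarrow> 'a \<Rightarrow> 'a \<Rightarrow> 'a \<Rightarrow> bool" where
  "is_glb r a b c \<longleftrightarrow> (c, a) \<in> r \<and> (c, b) \<in> r \<and>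
     (\<forall>e. (e, a) \<in> r \<and> (e, b) \<in> r \<longrightarrow> (e, c) \<in> r)"

text \<open>
  The one-element interval below the empty face counts as the cube of dimension \<open>-1\<close>, hence the
  cube condition is imposed on the nonempty faces only.
\<close>

definition cubical_complex :: "'a rel \<Rightarrow> bool" where
  "cubical_complex K \<longleftrightarrow>
     finite (Field K) \<and> Partial_order K \<and> (\<exists>b. is_minimum K b) \<and>
     (\<forall>F\<in>faces K. \<exists>k. abstract_cube k (Restr K (under K F))) \<and>
     (\<forall>F\<in>Field K. \<forall>G\<in>Field K. \<exists>H. is_glb K F G H)"

definition face_dim :: "'a rel \<Rightarrow> 'a \<Rightarrow> int" where
  "face_dim K F =
     (if F = empty_face K then -1 else int (THE k. abstract_cube k (Restr K (under K F))))"

definition complex_dim :: "'a rel \<Rightarrow> int" where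
  "complex_dim K = Max (face_dim K ` Field K)"

definition maximal_faces :: "'a rel \<Rightarrow> 'a set" where
  "maximal_faces K = {F \<in> Field K. \<forall>G. (F, G) \<in> K \<longrightarrow> G = F}"

definition pure_complex :: "'a rel \<Rightarrow> bool" where
  "pure_complex K \<longleftrightarrow>
     (\<forall>F\<in>maximal_faces K. \<forall>G\<in>maximal_faces K. face_dim K F = face_dim K G)"

definition subcomplex :: "'a rel \<Rightarrow> 'a set \<Rightarrow> bool" where
  "subcomplex K A \<longleftrightarrow> A \<noteq> {} \<and> ofilter K A"

subsection \<open>Topology of cubical complexes\<close>

text \<open>
  Geometric realization of the order complex of a finite poset, in barycentric coordinates indexed
  by the elements of the poset (the vertices of the order complex).
\<close>

definition order_complex_points :: "'a rel \<Rightarrow> ('a \<Rightarrow> real) set" where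
  "order_complex_points r =
     {w. (\<forall>a. 0 \<le> w a) \<and> {a. w a \<noteq> 0} \<in> Chains r \<and> (\<Sum>a\<in>Field r. w a) = 1}"

definition complex_points :: "'a rel \<Rightarrow> ('a \<Rightarrow> real) set" where
  "complex_points K = order_complex_points (Restr K (faces K))"

definition complex_space :: "'a rel \<Rightarrow> ('a \<Rightarrow> real) topology" where
  "complex_space K = subtopology (powertop_real UNIV) (complex_points K)"

definition ball_space :: "nat \<Rightarrow> (nat \<Rightarrow> real) topology" where
  "ball_space n = subtopology (Euclidean_space n) {x. (\<Sum>i<n. (x i)\<^sup>2) \<le> 1}"

definition is_ball :: "nat \<Rightarrow> 'a rel \<Rightarrow> bool" where
  "is_ball n L \<longleftrightarrow> complex_space L homeomorphic_space ball_space n"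

text \<open>
  The boundary of a topological ball is the preimage of the unit sphere under a homeomorphism to
  the standard ball; by invariance of domain it does not depend on the homeomorphism.
\<close>

definition ball_boundary :: "nat \<Rightarrow> 'a rel \<Rightarrow> ('a \<Rightarrow> real) set" where
  "ball_boundary n L =
     {p \<in> complex_points L.
        \<exists>h. homeomorphic_map (complex_space L) (ball_space n) h \<and> (\<Sum>i<n. (h p i)\<^sup>2) = 1}"

definition interior_faces :: "nat \<Rightarrow> 'a rel \<Rightarrow> 'a set" where
  "interior_faces n L =
     {E \<in> faces L. \<not> complex_points (Restr L (under L E)) \<subseteq> ball_boundary n L}"

subsection \<open>Cubical subdivisions\<close>

definition restriction_faces :: "'a rel \<Rightarrow> 'b rel \<Rightarrow> ('b \<Rightarrow> 'a) \<Rightarrow> 'a \<Rightarrow> 'b set" where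
  "restriction_faces K K' \<sigma> F = {E \<in> faces K'. \<sigma> E \<in> faces K \<and> (\<sigma> E, F) \<in> K} \<union> {empty_face K'}"

definition restriction :: "'a rel \<Rightarrow> 'b rel \<Rightarrow> ('b \<Rightarrow> 'a) \<Rightarrow> 'a \<Rightarrow> 'b rel" where
  "restriction K K' \<sigma> F = Restr K' (restriction_faces K K' \<sigma> F)"

definition cubical_subdivision :: "'a rel \<Rightarrow> 'b rel \<Rightarrow> ('b \<Rightarrow> 'a) \<Rightarrow> bool" where
  "cubical_subdivision K K' \<sigma> \<longleftrightarrow>
     cubical_complex K \<and> cubical_complex K' \<and> \<sigma> \<in> faces K' \<rightarrow> faces K \<and>
     (\<forall>F\<in>faces K.
        subcomplex K' (restriction_faces K K' \<sigma> F) \<and>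
        is_ball (nat (face_dim K F)) (restriction K K' \<sigma> F) \<and>
        {E \<in> faces K'. \<sigma> E = F} =
          interior_faces (nat (face_dim K F)) (restriction K K' \<sigma> F))"

subsection \<open>The polynomials\<close>

text \<open>
  Here \<open>[:0, 1:]\<close>, \<open>[:0, 2:]\<close> and \<open>[:1, -1:]\<close> are \<open>x\<close>, \<open>2x\<close> and \<open>1 - x\<close>. Every argument of \<^const>\<open>nat\<close> is
  nonnegative for the faces of a cubical complex that occur.
\<close>

definition h_sc :: "'a rel \<Rightarrow> int poly" where
  "h_sc L = (\<Sum>E\<in>faces L.
     [:0, 2:] ^ nat (face_dim L E) * [:1, -1:] ^ nat (complex_dim L - face_dim L E))"

definition local_h :: "'a rel \<Rightarrow> 'b rel \<Rightarrow> ('b \<Rightarrow> 'a) \<Rightarrow> 'a \<Rightarrow> int poly" where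
  "local_h K K' \<sigma> F = (\<Sum>G\<in>{G \<in> faces K. (G, F) \<in> K}.
     (-1) ^ nat (face_dim K F - face_dim K G) * h_sc (restriction K K' \<sigma> G))"

definition h_link :: "int \<Rightarrow> 'a rel \<Rightarrow> 'a \<Rightarrow> int poly" where
  "h_link d K F = (\<Sum>G\<in>{G \<in> Field K. (F, G) \<in> K}.
     [:0, 1:] ^ nat (face_dim K G - face_dim K F) * [:1, -1:] ^ nat (d - face_dim K G))"

end

theory Submission
  imports "HOL-Homology.Invariance_of_Domain" Defs
begin

text \<open>\<open>h_sc\<close> normalises \<open>K'_G\<close> by the combinatorial dimension of
  that complex, while the hypothesis only says that its realization is a ball of dimension
  \<open>dim G\<close>. Once the two agree, \<open>(1 - x) ^ (dim G - dim E)\<close> and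
  \<open>(1 - x) ^ (d - dim G)\<close> merge into \<open>(1 - x) ^ (d - dim E)\<close>, which no
  longer sees \<open>G\<close>; the rest is summation over intervals. The obstacle is that a
  realization is not a priori an open piece of Euclidean space and the ball is closed, so invariance
  of domain applies to neither directly. Two injective maps with open Euclidean domains are
  therefore built, one from an open simplex to the ball and one from an open part of the ball to the
  simplex, and each gives one inequality. Intervals are Boolean because a nonempty face of a cube
  fixes some coordinates at 0 or 1, and a larger face only chooses which of these to release. The
  last sum is 1 because, for fixed \<open>H\<close>, summing the signs over \<open>G\<close> gives a
  power of \<open>1 - 1\<close>, which vanishes unless \<open>H = \<sigma> E\<close>.\<close>

text \<open>
  An interval \<open>[G, H]\<close> of nonempty faces of a cubical complex is Boolean of rank
  \<open>dim H - dim G\<close>. Expanding the right-hand side and summing over \<open>F\<close> with \<open>G \<le> F \<le> H\<close> turns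
  \<open>(-1) ^ (dim F - dim G) * x ^ (dim H - dim F)\<close> into \<open>(x - 1) ^ (dim H - dim G)\<close>, so a face \<open>E\<close> of
  \<open>K'\<close> contributes \<open>(2x) ^ dim E * (1 - x) ^ (d - dim E)\<close> times the sum of
  \<open>(-1) ^ (dim H - dim G)\<close> over all \<open>\<sigma> E \<le> G \<le> H\<close>, and this sum is 1.
  The topological input is \<open>dim K'_G = dim G\<close>: a longest chain of faces spans a simplex whose
  relative interior is open in the order complex, so invariance of domain identifies its dimension
  with that of the ball.
\<close>

section \<open>The dimension of an order complex homeomorphic to a ball\<close>

lemma Euclidean_space_eq_top_of_set: "Euclidean_space n = top_of_set {x. \<forall>i\<ge>n. x i = 0}"
  by (simp add: Euclidean_space_def euclidean_product_topology)

text \<open>If \<open>n < m\<close>, then \<open>f\<close> read as a map into m-space has an open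
  image by invariance of domain. That image lies in the hyperplane where coordinate \<open>n\<close>
  vanishes, which has empty interior.\<close>

lemma dim_le_of_injective_continuous:
  fixes f :: "(nat \<Rightarrow> real) \<Rightarrow> nat \<Rightarrow> real"
  assumes U: "openin (top_of_set {x. \<forall>i\<ge>m. x i = 0}) U" "U \<noteq> {}"
    and f: "continuous_on U f" "\<And>x i. x \<in> U \<Longrightarrow> i \<ge> n \<Longrightarrow> f x i = 0" "inj_on f U"
  shows "m \<le> n"
proof (rule ccontr)
  assume "\<not> m \<le> n"
  then have nm: "n < m" by simp
  have sub: "U \<subseteq> {x. \<forall>i\<ge>m. x i = 0}"
    using U(1) openin_imp_subset by blast
  have "openin (Euclidean_space m) (f ` U)"
  proof (rule invariance_of_domain_Euclidean_space)
    show "openin (Euclidean_space m) U"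
      using U by (simp add: Euclidean_space_eq_top_of_set)
    have "f ` U \<subseteq> {x. \<forall>i\<ge>m. x i = 0}"
      using f(2) nm by auto
    then show "continuous_map (subtopology (Euclidean_space m) U) (Euclidean_space m) f"
      using f(1) sub
      by (auto simp: Euclidean_space_eq_top_of_set subtopology_subtopology Int_absorb1
          continuous_map_in_subtopology image_subset_iff_funcset)
  qed fact
  then obtain T where T: "open T" "f ` U = {x. \<forall>i\<ge>m. x i = 0} \<inter> T"
    by (auto simp: Euclidean_space_eq_top_of_set openin_open)
  obtain u where "u \<in> U" using U(2) by blast
  then have fu: "f u \<in> T" "\<forall>i\<ge>m. f u i = 0" using T(2) by blast+
  \<comment> \<open>This line leaves the hyperplane at once but stays in m-space, since
    \<open>n < m\<close>.\<close>
  define \<gamma> where "\<gamma> = (\<lambda>t::real. (f u)(n := t))"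
  have "continuous_on UNIV \<gamma>"
  proof (rule continuous_on_coordinatewise_then_product)
    show "continuous_on UNIV (\<lambda>t. \<gamma> t i)" for i
      by (cases "i = n") (simp_all add: \<gamma>_def)
  qed
  then have "open (\<gamma> -` T)"
    using T(1) open_vimage by blast
  moreover have "0 \<in> \<gamma> -` T"
    using fu f(2)[OF \<open>u \<in> U\<close>, of n] by (simp add: \<gamma>_def fun_upd_idem)
  ultimately obtain e where e: "e > 0" "ball 0 e \<subseteq> \<gamma> -` T"
    using open_contains_ball by blast
  have "\<gamma> (e/2) \<in> T" using e by (auto simp: subset_iff)
  moreover have "\<forall>i\<ge>m. \<gamma> (e/2) i = 0" using fu nm by (auto simp: \<gamma>_def)
  ultimately have "\<gamma> (e/2) \<in> f ` U" using T(2) by blast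
  then have "\<gamma> (e/2) n = 0" using f(2) by force
  then show False using e by (simp add: \<gamma>_def)
qed

text \<open>Maximality of the chain \<open>C\<close> is what makes its open simplex open in the
  realization: a nearby point still has positive weight on all of \<open>C\<close>, and any further
  vertex in its support would give a longer chain.\<close>

lemma order_complex_ball_imp_chain_card:
  fixes r :: "'a rel"
  assumes fin: "finite (Field r)"
    and C: "C \<in> Chains r" "card C = Suc m"
    and max: "\<And>D. D \<in> Chains r \<Longrightarrow> card D \<le> Suc m"
    and hom: "subtopology (powertop_real UNIV) (order_complex_points r)
                homeomorphic_space ball_space n"
  shows "m = n"
proof -
  define P where "P = order_complex_points r"
  define B where "B = {x::nat\<Rightarrow>real. (\<forall>i\<ge>n. x i = 0) \<and> (\<Sum>i<n. (x i)\<^sup>2) \<le> 1}"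
  have chain_Field: "D \<subseteq> Field r" if "D \<in> Chains r" for D
    using that by (auto simp: Chains_def Field_def)
  have finC: "finite C" and CF: "C \<subseteq> Field r"
    using chain_Field[OF C(1)] fin finite_subset by auto
  have topB: "ball_space n = top_of_set B"
    by (simp add: ball_space_def Euclidean_space_eq_top_of_set subtopology_subtopology B_def Collect_conj_eq)
  obtain h h' where hh': "homeomorphic_maps (top_of_set P) (top_of_set B) h h'"
    using hom unfolding homeomorphic_space_def topB P_def euclidean_product_topology by auto
  then have h: "continuous_on P h" "h \<in> P \<rightarrow> B" "continuous_on B h'" "h' \<in> B \<rightarrow> P"
      and inv: "\<And>p. p \<in> P \<Longrightarrow> h' (h p) = p" "\<And>y. y \<in> B \<Longrightarrow> h (h' y) = y"
    by (auto simp: homeomorphic_maps_def continuous_map_in_subtopology image_subset_iff_funcset)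
  obtain e where e: "bij_betw e {..<Suc m} C"
    using finC C(2) by (metis bij_betw_from_nat_into_finite)
  define q where "q = inv_into {..<Suc m} e"
  have eC: "e i \<in> C" if "i \<le> m" for i
    using e that by (auto simp: bij_betw_def)
  have qe: "q (e i) = i" if "i \<le> m" for i
    unfolding q_def using e that by (simp add: bij_betw_inv_into_left)
  have eq: "e (q c) = c" "q c \<le> m" if "c \<in> C" for c
    using bij_betw_inv_into_right[OF e that] bij_betwE[OF bij_betw_inv_into[OF e]] that
    by (auto simp: q_def less_Suc_eq_le)
  have sumC: "(\<Sum>c\<in>C. g c) = (\<Sum>i<m. g (e i)) + g (e m)" for g :: "'a \<Rightarrow> real"
    using sum.reindex_bij_betw[OF e, of g] by simp

  \<comment> \<open>Barycentric coordinates on the simplex of \<open>C\<close>: the first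
    \<open>m\<close> are free, and the vertex \<open>e m\<close> receives the remaining weight. The
    set \<open>U\<close> is where all weights are positive.\<close>
  define w where "w = (\<lambda>p x. if x \<in> C then (if q x < m then p (q x) else 1 - (\<Sum>i<m. p i)) else (0::real))"
  define U where "U = {p::nat\<Rightarrow>real. (\<forall>i\<ge>m. p i = 0)} \<inter> ({p. (\<Sum>i<m. p i) < 1} \<inter> (\<Inter>i<m. {p. 0 < p i}))"
  have wU: "w p \<in> P" "\<And>c. c \<in> C \<Longrightarrow> w p c > 0" if "p \<in> U" for p
  proof -
    show pos: "w p c > 0" if "c \<in> C" for c
      using \<open>p \<in> U\<close> that by (auto simp: w_def U_def)
    have supp: "{a. w p a \<noteq> 0} = C"
      using pos by (force simp: w_def)
    have "(\<Sum>a\<in>Field r. w p a) = (\<Sum>a\<in>C. w p a)"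
      by (rule sum.mono_neutral_right[OF fin CF]) (auto simp: w_def)
    also have "\<dots> = 1" 
      unfolding sumC by (simp add: w_def eC qe)
    finally have "(\<Sum>a\<in>Field r. w p a) = 1" .
    moreover have "0 \<le> w p a" for a
      using pos[of a] by (cases "a \<in> C") (auto simp: w_def)
    ultimately show "w p \<in> P"
      using supp C(1) by (auto simp: P_def order_complex_points_def)
  qed
  \<comment> \<open>The barycenter, with equal weight on all \<open>m + 1\<close> vertices.\<close>
  have Une: "(\<lambda>i. if i < m then 1 / real (Suc m) else 0) \<in> U"
    by (auto simp: U_def divide_simps)

  have "m \<le> n"
  proof (rule dim_le_of_injective_continuous)
    have "open {p::nat\<Rightarrow>real. (\<Sum>i<m. p i) < 1}" "\<And>i. open {p::nat\<Rightarrow>real. 0 < p i}"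
      by (intro open_Collect_less continuous_intros continuous_on_product_coordinates)+
    then show "openin (top_of_set {x. \<forall>i\<ge>m. x i = 0}) U"
      unfolding U_def openin_open by (intro exI conjI refl open_Int open_INT) auto
    show "U \<noteq> {}" using Une by blast
    have "continuous_on U w"
    proof (rule continuous_on_coordinatewise_then_product)
      have coord: "continuous_on U (\<lambda>p. p j)" for j :: nat
        by (rule continuous_on_product_then_coordinatewise[OF continuous_on_id])
      show "continuous_on U (\<lambda>p. w p a)" for a
        by (cases "a \<in> C"; cases "q a < m") (auto simp: w_def intro!: coord continuous_intros)
    qed
    then show "continuous_on U (\<lambda>p. h (w p))"
      using continuous_on_compose2[OF h(1)] wU by blast
    show "h (w p) i = 0" if "p \<in> U" "i \<ge> n" for p i
      using wU[OF that(1)] h(2) that(2) by (auto simp: B_def Pi_iff)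
    show "inj_on (\<lambda>p. h (w p)) U"
    proof (rule inj_onI)
      fix p p' assume pp: "p \<in> U" "p' \<in> U" "h (w p) = h (w p')"
      then have w: "w p = w p'" using inv(1) wU by metis
      show "p = p'"
      proof
        fix i
        show "p i = p' i"
        proof (cases "i < m")
          case True
          then show ?thesis using fun_cong[OF w, of "e i"] by (simp add: w_def eC qe)
        qed (use pp in \<open>auto simp: U_def\<close>)
      qed
    qed
  qed

  moreover have "n \<le> m"
  proof (rule dim_le_of_injective_continuous)
    \<comment> \<open>The closed ball is not open in n-space, so the domain \<open>V\<close> is cut
      out of the open ball \<open>OB\<close>.\<close>
    define OB where "OB = {x::nat\<Rightarrow>real. (\<forall>i\<ge>n. x i = 0)} \<inter> {x. (\<Sum>i<n. (x i)\<^sup>2) < 1}"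
    define V where "V = OB \<inter> (\<Inter>c\<in>C. (\<lambda>y. h' y c) -` {0<..})"
    have OBB: "OB \<subseteq> B" by (auto simp: OB_def B_def)
    have "open {x::nat\<Rightarrow>real. (\<Sum>i<n. (x i)\<^sup>2) < 1}"
      by (intro open_Collect_less continuous_intros continuous_on_product_coordinates)
    then have oOB: "openin (top_of_set {x. \<forall>i\<ge>n. x i = 0}) OB"
      unfolding OB_def openin_open by blast
    have cc: "continuous_on B (\<lambda>y. h' y c)" for c
      using h(3) by (rule continuous_on_product_then_coordinatewise)
    have Cne: "C \<noteq> {}" using C(2) by auto
    have "openin (top_of_set OB) (\<Inter>c\<in>C. OB \<inter> (\<lambda>y. h' y c) -` {0<..})"
      using finC Cne continuous_on_subset[OF cc OBB]
      by (intro openin_INT2 continuous_openin_preimage_gen) auto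
    moreover have "(\<Inter>c\<in>C. OB \<inter> (\<lambda>y. h' y c) -` {0<..}) = V"
      using Cne by (auto simp: V_def)
    ultimately show "openin (top_of_set {x. \<forall>i\<ge>n. x i = 0}) V"
      using openin_trans oOB by metis
    show "V \<noteq> {}"
    proof -
      define p where "p = w (\<lambda>i. if i < m then 1 / real (Suc m) else 0)"
      have p: "p \<in> P" "\<And>c. c \<in> C \<Longrightarrow> p c > 0"
        using wU[OF Une] by (auto simp: p_def)
      define y where "y = h p"
      have yB: "y \<in> B" using h(2) p(1) by (auto simp: y_def)
      \<comment> \<open>The image \<open>y\<close> of the barycenter may lie on the sphere. Moving
        it slightly towards the origin reaches the open ball, and by continuity the weights on
        \<open>C\<close> stay positive for \<open>t\<close> near 1.\<close>
      define \<gamma> where "\<gamma> = (\<lambda>t::real. \<lambda>i. t * y i)"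
      have sq: "(\<Sum>i<n. (\<gamma> t i)\<^sup>2) = t\<^sup>2 * (\<Sum>i<n. (y i)\<^sup>2)" for t
        by (simp add: \<gamma>_def power_mult_distrib sum_distrib_left)
      have y0: "(\<Sum>i<n. (y i)\<^sup>2) \<ge> 0" "(\<Sum>i<n. (y i)\<^sup>2) \<le> 1" "\<And>i. i \<ge> n \<Longrightarrow> y i = 0"
        using yB by (auto simp: B_def intro: sum_nonneg)
      have \<gamma>B: "\<gamma> t \<in> B" if "t \<in> {0..1}" for t
        using y0 that mult_mono[of "t\<^sup>2" 1 "(\<Sum>i<n. (y i)\<^sup>2)" 1]
        by (auto simp: B_def sq power_le_one) (simp add: \<gamma>_def)
      have \<gamma>OB: "\<gamma> t \<in> OB" if "0 \<le> t" "t < 1" for t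
      proof -
        have "t\<^sup>2 < 1" using that by (simp add: power_less_one_iff)
        moreover have "t\<^sup>2 * (\<Sum>i<n. (y i)\<^sup>2) \<le> t\<^sup>2 * 1"
          using y0 by (intro mult_left_mono) auto
        ultimately show ?thesis
          using y0 by (auto simp: OB_def sq) (simp add: \<gamma>_def)
      qed
      have "continuous_on {0..1} \<gamma>"
        unfolding \<gamma>_def by (intro continuous_on_coordinatewise_then_product continuous_intros)
      then have "continuous_on {0..1} (\<lambda>t. h' (\<gamma> t) c)" for c
        using continuous_on_compose2[OF cc] \<gamma>B by blast
      then have "openin (top_of_set {0..1}) (\<Inter>c\<in>C. {0..1} \<inter> (\<lambda>t. h' (\<gamma> t) c) -` {0<..})"
        using finC Cne by (intro openin_INT2 continuous_openin_preimage_gen) auto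
      then obtain T where T: "open T" "(\<Inter>c\<in>C. {0..1} \<inter> (\<lambda>t. h' (\<gamma> t) c) -` {0<..}) = {0..1} \<inter> T"
        by (auto simp: openin_open)
      have "\<gamma> 1 = y" by (simp add: \<gamma>_def)
      then have "1 \<in> (\<Inter>c\<in>C. {0..1} \<inter> (\<lambda>t. h' (\<gamma> t) c) -` {0<..})"
        using p inv(1) by (auto simp: y_def)
      then have "1 \<in> T" using T(2) by blast
      then obtain \<epsilon> where \<epsilon>: "\<epsilon> > 0" "ball 1 \<epsilon> \<subseteq> T"
        using T(1) open_contains_ball by blast
      \<comment> \<open>The maximum with 0 keeps \<open>t\<close> in the unit interval when
        \<open>\<epsilon>\<close> is large.\<close>
      define t where "t = max 0 (1 - \<epsilon>/2)"
      have t: "0 \<le> t" "t < 1" "t \<in> T"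
        using \<epsilon> by (auto simp: t_def dist_real_def subset_iff max_def)
      then have "t \<in> (\<Inter>c\<in>C. {0..1} \<inter> (\<lambda>t. h' (\<gamma> t) c) -` {0<..})"
        using T(2) by auto
      then have "\<gamma> t \<in> V"
        using \<gamma>OB t by (auto simp: V_def Cne)
      then show ?thesis by blast
    qed
    \<comment> \<open>The weight at \<open>e m\<close> is dropped; it is recovered from the others
      because the weights on \<open>C\<close> sum to 1.\<close>
    define g where "g = (\<lambda>y i. if i < m then h' y (e i) else 0)"
    have VB: "V \<subseteq> B" using OBB by (auto simp: V_def)
    show "continuous_on V g"
    proof (rule continuous_on_coordinatewise_then_product)
      show "continuous_on V (\<lambda>y. g y i)" for i
        by (cases "i < m") (simp_all add: g_def continuous_on_subset[OF cc VB])
    qed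
    show "g y i = 0" if "i \<ge> m" for y i using that by (simp add: g_def)
    have supp: "h' y a = 0" if "y \<in> V" "a \<notin> C" for y a
    proof (rule ccontr)
      assume "h' y a \<noteq> 0"
      have "h' y \<in> P" using h(4) VB that(1) by blast
      then have D: "{a. h' y a \<noteq> 0} \<in> Chains r"
        by (simp add: P_def order_complex_points_def)
      have "insert a C \<subseteq> {a. h' y a \<noteq> 0}"
        using \<open>h' y a \<noteq> 0\<close> that(1) by (force simp: V_def)
      then have "card (insert a C) \<le> card {a. h' y a \<noteq> 0}"
        using chain_Field[OF D] fin by (meson card_mono finite_subset)
      then show False
        using max[OF D] that(2) finC C(2) by simp
    qed
    have last: "h' y (e m) = 1 - (\<Sum>i<m. h' y (e i))" if "y \<in> V" for y
    proof -
      have "h' y \<in> P" using h(4) VB that by blast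
      then have "1 = (\<Sum>a\<in>Field r. h' y a)"
        by (simp add: P_def order_complex_points_def)
      also have "\<dots> = (\<Sum>a\<in>C. h' y a)"
        by (rule sum.mono_neutral_right[OF fin CF]) (use supp[OF that] in auto)
      finally show ?thesis by (simp add: sumC)
    qed
    show "inj_on g V"
    proof (rule inj_onI)
      fix y y' assume yy: "y \<in> V" "y' \<in> V" "g y = g y'"
      have lt: "h' y (e i) = h' y' (e i)" if "i < m" for i
        using fun_cong[OF yy(3), of i] that by (simp add: g_def)
      have "h' y (e i) = h' y' (e i)" if "i \<le> m" for i
        using lt last[OF yy(1)] last[OF yy(2)] that by (cases "i = m") auto
      then have "h' y a = h' y' a" for a
        using supp yy eq by (cases "a \<in> C") metis+
      then have "h' y = h' y'" by blast
      then show "y = y'" using inv(2) VB yy by (metis subsetD)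
    qed
  qed
  ultimately show ?thesis by simp
qed

section \<open>Faces of the cube as sign vectors\<close>

text \<open>In a sign vector, the value \<open>2\<close> marks a coordinate that varies over the whole of \<open>[0, 1]\<close>.\<close>

lemma lookup_scaleR [simp]: "Poly_Mapping.lookup (r *\<^sub>R x) i = r *\<^sub>R Poly_Mapping.lookup x i"
proof -
  have "{i. r *\<^sub>R Poly_Mapping.lookup x i \<noteq> 0} \<subseteq> Poly_Mapping.keys x"
    by (auto simp: in_keys_iff)
  then have "finite {i. r *\<^sub>R Poly_Mapping.lookup x i \<noteq> 0}"
    using finite_keys finite_subset by blast
  then show ?thesis by (simp add: scaleR_poly_mapping_def)
qed

definition signs :: "nat \<Rightarrow> (nat \<Rightarrow> nat) set" where
  "signs d = PiE {..<d} (\<lambda>_. {0, 1, 2})"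

text \<open>The product order of the three-element poset with 2 above the incomparable values 0 and
  1, that is, of the face poset of a segment.\<close>

definition sign_le :: "nat \<Rightarrow> (nat \<Rightarrow> nat) \<Rightarrow> (nat \<Rightarrow> nat) \<Rightarrow> bool" where
  "sign_le d g g' \<longleftrightarrow> (\<forall>i<d. g' i = 2 \<or> g' i = g i)"

definition free_coords :: "nat \<Rightarrow> (nat \<Rightarrow> nat) \<Rightarrow> nat set" where
  "free_coords d g = {i. i < d \<and> g i = 2}"

lemma finite_free_coords [simp]: "finite (free_coords k g)"
  by (simp add: free_coords_def)

definition sign_face :: "nat \<Rightarrow> (nat \<Rightarrow> nat) \<Rightarrow> (nat \<Rightarrow>\<^sub>0 real) set" where
  "sign_face d g = {p \<in> unit_cube d. \<forall>i<d. g i \<noteq> 2 \<longrightarrow> Poly_Mapping.lookup p i = real (g i)}"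

lemma signs_values: "g \<in> signs d \<Longrightarrow> i < d \<Longrightarrow> g i \<in> {0, 1, 2}"
  using PiE_mem[of g "{..<d}" "\<lambda>_. {0, 1, 2}" i] by (simp add: signs_def)

lemma obtain_poly_mapping:
  obtains p :: "nat \<Rightarrow>\<^sub>0 real" where "\<And>i. Poly_Mapping.lookup p i = (if i < d then f i else 0)"
proof
  have "finite {i. (if i < d then f i else 0) \<noteq> (0::real)}"
    by (rule finite_subset[of _ "{..<d}"]) auto
  then show "\<And>i. Poly_Mapping.lookup (Abs_poly_mapping (\<lambda>i. if i < d then f i else 0)) i =
      (if i < d then f i else (0::real))"
    by simp
qed

text \<open>The barycenter of the face is a test point for inclusion: its free coordinates are 1/2,
  so a face containing it cannot fix any of them at 0 or 1.\<close>

lemma sign_face_center: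
  assumes "g \<in> signs d"
  obtains p where "p \<in> sign_face d g"
    "\<And>i. i < d \<Longrightarrow> Poly_Mapping.lookup p i = (if g i = 2 then 1/2 else real (g i))"
proof -
  obtain p :: "nat \<Rightarrow>\<^sub>0 real"
    where p: "\<And>i. Poly_Mapping.lookup p i = (if i < d then (if g i = 2 then 1/2 else real (g i)) else 0)"
    by (rule obtain_poly_mapping[of d "\<lambda>i. if g i = 2 then 1/2 else real (g i)"]) blast
  have "0 \<le> Poly_Mapping.lookup p i \<and> Poly_Mapping.lookup p i \<le> 1" if "i < d" for i
    using signs_values[OF assms that] that by (auto simp: p)
  then have "p \<in> sign_face d g"
    by (simp add: sign_face_def unit_cube_def p)
  then show thesis using that p by simp
qed

lemma sign_face_subset_iff:
  assumes "g \<in> signs d" "g' \<in> signs d"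
  shows "sign_face d g \<subseteq> sign_face d g' \<longleftrightarrow> sign_le d g g'"
proof
  assume sub: "sign_face d g \<subseteq> sign_face d g'"
  obtain p where p: "p \<in> sign_face d g"
    "\<And>i. i < d \<Longrightarrow> Poly_Mapping.lookup p i = (if g i = 2 then 1/2 else real (g i))"
    using sign_face_center[OF assms(1)] by blast
  have "g' i = 2 \<or> g' i = g i" if "i < d" for i
  proof (rule ccontr)
    assume ne: "\<not> (g' i = 2 \<or> g' i = g i)"
    then have "Poly_Mapping.lookup p i = real (g' i)"
      using sub p(1) that by (auto simp: sign_face_def)
    then have "g i = 2 \<and> real (g' i) = 1/2"
      using p(2)[OF that] ne by (auto split: if_splits)
    moreover have "real (g' i) = 0 \<or> real (g' i) = 1"
      using signs_values[OF assms(2) that] ne by auto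
    ultimately show False by linarith
  qed
  then show "sign_le d g g'" by (simp add: sign_le_def)
next
  assume "sign_le d g g'"
  then show "sign_face d g \<subseteq> sign_face d g'"
    unfolding sign_face_def sign_le_def by (intro subsetI) (smt (verit) mem_Collect_eq)
qed

lemma sign_le_antisym:
  assumes "g \<in> signs d" "g' \<in> signs d" "sign_le d g g'" "sign_le d g' g"
  shows "g = g'"
proof (rule PiE_ext)
  show "g \<in> PiE {..<d} (\<lambda>_. {0, 1, 2})" "g' \<in> PiE {..<d} (\<lambda>_. {0, 1, 2})"
    using assms by (simp_all add: signs_def)
  show "g i = g' i" if "i \<in> {..<d}" for i
    using assms(3,4) that unfolding sign_le_def lessThan_iff by metis
qed

text \<open>The points 0 and 1 are extreme in the unit interval. Applied coordinatewise, this
  governs the faces of the cube.\<close>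

lemma segment_unit_interval_endpoint:
  fixes a b u :: real
  assumes "0 \<le> a" "a \<le> 1" "0 \<le> b" "b \<le> 1" "0 < u" "u < 1"
  shows "(1 - u) * a + u * b = 0 \<longleftrightarrow> a = 0 \<and> b = 0"
    and "(1 - u) * a + u * b = 1 \<longleftrightarrow> a = 1 \<and> b = 1"
proof -
  have zero: "(1 - u) * x + u * y = 0 \<longleftrightarrow> x = 0 \<and> y = 0" if "0 \<le> x" "0 \<le> y" for x y :: real
    using that assms by (subst add_nonneg_eq_0_iff) auto
  show "(1 - u) * a + u * b = 0 \<longleftrightarrow> a = 0 \<and> b = 0"
    using zero assms by blast
  show "(1 - u) * a + u * b = 1 \<longleftrightarrow> a = 1 \<and> b = 1"
    using zero[of "1 - a" "1 - b"] assms by (auto simp: algebra_simps)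
qed

lemma sign_face_face_of:
  assumes "g \<in> signs d"
  shows "sign_face d g face_of unit_cube d"
  unfolding face_of_def
proof (intro conjI ballI impI)
  show "sign_face d g \<subseteq> unit_cube d" by (auto simp: sign_face_def)
  show "convex (sign_face d g)"
    unfolding convex_alt
  proof (intro ballI allI impI)
    fix x y :: "nat \<Rightarrow>\<^sub>0 real" and u :: real
    assume xy: "x \<in> sign_face d g" "y \<in> sign_face d g" and u: "0 \<le> u \<and> u \<le> 1"
    have "0 \<le> (1 - u) * a + u * b \<and> (1 - u) * a + u * b \<le> 1" 
      if "0 \<le> a" "a \<le> 1" "0 \<le> b" "b \<le> 1" for a b
      using u that convex_bound_le[of a 1 b "1-u" u] by auto
    moreover have "(1 - u) * a + u * a = a" for a by (simp add: algebra_simps)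
    ultimately show "(1 - u) *\<^sub>R x + u *\<^sub>R y \<in> sign_face d g"
      using xy by (simp add: sign_face_def unit_cube_def lookup_add)
  qed
  fix a b x
  assume ab: "a \<in> unit_cube d" "b \<in> unit_cube d" and x: "x \<in> sign_face d g" "x \<in> open_segment a b"
  obtain u where u: "0 < u" "u < 1" "x = (1 - u) *\<^sub>R a + u *\<^sub>R b"
    using x(2) by (auto simp: in_segment)
  have "Poly_Mapping.lookup a i = real (g i) \<and> Poly_Mapping.lookup b i = real (g i)"
    if i: "i < d" "g i \<noteq> 2" for i
  proof -
    have "g i = 0 \<or> g i = 1" using signs_values[OF assms i(1)] i(2) by auto
    moreover have "(1 - u) * Poly_Mapping.lookup a i + u * Poly_Mapping.lookup b i = real (g i)"
      using x(1) i by (auto simp: u(3) sign_face_def lookup_add)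
    ultimately show ?thesis
      using ab i u segment_unit_interval_endpoint[of "Poly_Mapping.lookup a i" "Poly_Mapping.lookup b i" u]
      by (auto simp: unit_cube_def)
  qed
  then show "a \<in> sign_face d g" "b \<in> sign_face d g" using ab by (auto simp: sign_face_def)
qed

text \<open>The sign vector records the coordinates that are constantly 0 or constantly 1 on
  \<open>A\<close>. For the converse inclusion, some \<open>q\<close> in \<open>A\<close> has all
  free coordinates strictly between 0 and 1; the segment from any \<open>p\<close> of the sign face
  through \<open>q\<close> can be prolonged inside the cube, and the face property then puts
  \<open>p\<close> into \<open>A\<close>.\<close>

lemma face_of_unit_cube_is_sign_face:
  assumes A: "A face_of unit_cube d" "A \<noteq> {}"
  obtains g where "g \<in> signs d" "A = sign_face d g"
proof -
  let ?l = "Poly_Mapping.lookup :: (nat \<Rightarrow>\<^sub>0 real) \<Rightarrow> _"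
  define g where "g = (\<lambda>i\<in>{..<d}. if \<forall>p\<in>A. ?l p i = 0 then 0 else if \<forall>p\<in>A. ?l p i = 1 then 1 else (2::nat))"
  have gs: "g \<in> signs d" by (auto simp: signs_def g_def)
  have sub: "A \<subseteq> unit_cube d" and conv: "convex A"
    and fc: "\<And>a b x. a \<in> unit_cube d \<Longrightarrow> b \<in> unit_cube d \<Longrightarrow> x \<in> A \<Longrightarrow> x \<in> open_segment a b \<Longrightarrow> a \<in> A"
    using A(1) unfolding face_of_def by blast+
  have range: "0 \<le> ?l p i" "?l p i \<le> 1" if "p \<in> unit_cube d" for p i
    using that by (cases "i < d"; auto simp: unit_cube_def)+
  have AS: "A \<subseteq> sign_face d g"
    using sub by (auto simp: sign_face_def g_def)
  define bad where "bad = (\<lambda>q. {i. i < d \<and> g i = 2 \<and> (?l q i = 0 \<or> ?l q i = 1)})"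
  have fin: "finite (bad q)" for q by (auto simp: bad_def)
  have "\<exists>q. q \<in> A \<and> (\<forall>q'. q' \<in> A \<longrightarrow> card (bad q) \<le> card (bad q'))"
    using ex_has_least_nat[of "\<lambda>q. q \<in> A" _ "\<lambda>q. card (bad q)"] A(2) by blast
  then obtain q where q: "q \<in> A" and least: "\<And>q'. q' \<in> A \<Longrightarrow> card (bad q) \<le> card (bad q')"
    by blast
  then have qc: "q \<in> unit_cube d" using sub by blast
  \<comment> \<open>A point of \<open>A\<close> with fewest integral free coordinates has none: otherwise a midpoint does better.\<close>
  have "bad q = {}"
  proof (rule ccontr)
    assume "bad q \<noteq> {}"
    then obtain i where i: "i < d" "g i = 2" "?l q i = 0 \<or> ?l q i = 1" by (auto simp: bad_def)
    then have "\<exists>p\<in>A. ?l p i \<noteq> ?l q i"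
      by (auto simp: g_def split: if_splits)
    then obtain p where p: "p \<in> A" "?l p i \<noteq> ?l q i" by blast
    define m where "m = (1 - 1/2::real) *\<^sub>R p + (1/2::real) *\<^sub>R q"
    have mA: "m \<in> A" 
      unfolding m_def using convexD_alt[OF conv p(1) q, of "1/2"] by simp
    have lm: "?l m j = (1 - 1/2) * ?l p j + 1/2 * ?l q j" for j
      by (simp add: m_def lookup_add)
    have end0: "?l m j = 0 \<longleftrightarrow> ?l p j = 0 \<and> ?l q j = 0" and end1: "?l m j = 1 \<longleftrightarrow> ?l p j = 1 \<and> ?l q j = 1" for j
      unfolding lm using range p(1) q sub
      by (intro segment_unit_interval_endpoint; auto)+
    \<comment> \<open>A coordinate of the midpoint is 0 or 1 only if \<open>p\<close> and
      \<open>q\<close> agree there at that endpoint, and they differ at \<open>i\<close>.\<close>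
    have "bad m \<subseteq> bad q - {i}"
      using p(2) i(3) by (auto simp: bad_def end0 end1)
    moreover have "i \<in> bad q" using i by (auto simp: bad_def)
    ultimately have "bad m \<subset> bad q" by blast
    then show False
      using psubset_card_mono[OF fin, of "bad m" q] least[OF mA] by simp
  qed
  then have inner: "0 < ?l q i" "?l q i < 1" if "i < d" "g i = 2" for i
    using that range[OF qc, of i] by (auto simp: bad_def less_le)
  have "sign_face d g \<subseteq> A"
  proof
    fix p assume p: "p \<in> sign_face d g"
    show "p \<in> A"
    proof (cases "p = q")
      case False
      define I where "I = free_coords d g"
      have finI: "finite I" by (auto simp: I_def free_coords_def)
      \<comment> \<open>Coordinates of \<open>q - p\<close> have absolute value at most 1, so a step
        of this length beyond \<open>q\<close> stays in the cube. The inserted 1 covers the case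
        without free coordinates.\<close>
      define \<epsilon> where "\<epsilon> = Min (insert 1 ((\<lambda>i. min (?l q i) (1 - ?l q i)) ` I))"
      have \<epsilon>0: "0 < \<epsilon>" unfolding \<epsilon>_def using finI inner
        by (subst Min_gr_iff) (auto simp: I_def free_coords_def)
      have \<epsilon>i: "\<epsilon> \<le> ?l q i" "\<epsilon> \<le> 1 - ?l q i" if "i < d" "g i = 2" for i
      proof -
        have "\<epsilon> \<le> min (?l q i) (1 - ?l q i)"
          unfolding \<epsilon>_def using finI that by (intro Min_le) (auto simp: I_def free_coords_def)
        then show "\<epsilon> \<le> ?l q i" "\<epsilon> \<le> 1 - ?l q i" by auto
      qed
      define r where "r = q + \<epsilon> *\<^sub>R (q - p)"
      have lr: "?l r i = ?l q i + \<epsilon> * (?l q i - ?l p i)" for i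
        by (simp add: r_def lookup_add lookup_minus)
      have pc: "p \<in> unit_cube d" using p by (auto simp: sign_face_def)
      have qs: "q \<in> sign_face d g" using q AS by blast
      have "0 \<le> ?l r i \<and> ?l r i \<le> 1" if i: "i < d" for i
      proof (cases "g i = 2")
        case True
        have "\<epsilon> * (?l q i - ?l p i) \<le> \<epsilon> * 1" "\<epsilon> * (-1) \<le> \<epsilon> * (?l q i - ?l p i)"
          using range[OF pc, of i] range[OF qc, of i] \<epsilon>0 by (intro mult_left_mono; linarith)+
        then show ?thesis using \<epsilon>i[OF i True] by (auto simp: lr)
      next
        case False
        then have "?l q i = ?l p i" using qs p i by (auto simp: sign_face_def)
        then show ?thesis using range[OF pc, of i] by (simp add: lr)
      qed
      moreover have "?l r i = 0" if "i \<ge> d" for i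
        using that pc qc by (simp add: lr unit_cube_def)
      ultimately have rc: "r \<in> unit_cube d" by (auto simp: unit_cube_def)
      have "q \<in> open_segment p r"
        unfolding in_segment
      proof (intro conjI exI)
        \<comment> \<open>Solving \<open>r = q + \<epsilon> (q - p)\<close> for \<open>q\<close>
          gives weight \<open>1 / (1 + \<epsilon>)\<close> on \<open>r\<close>.\<close>
        show "0 < 1 / (1 + \<epsilon>)" "1 / (1 + \<epsilon>) < 1" using \<epsilon>0 by auto
        show "q = (1 - 1 / (1 + \<epsilon>)) *\<^sub>R p + (1 / (1 + \<epsilon>)) *\<^sub>R r"
        proof (rule poly_mapping_eqI)
          fix i show "?l q i = ?l ((1 - 1 / (1 + \<epsilon>)) *\<^sub>R p + (1 / (1 + \<epsilon>)) *\<^sub>R r) i"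
            using \<epsilon>0 by (simp add: lookup_add lr divide_simps) (simp add: algebra_simps)
        qed
        show "p \<noteq> r"
        proof
          assume "p = r"
          then have "(1 + \<epsilon>) * (?l q i - ?l p i) = 0" for i
            using lr[of i] by (simp add: algebra_simps)
          then have "?l q i = ?l p i" for i using \<epsilon>0 by simp
          then show False using False poly_mapping_eqI by metis
        qed
      qed
      then show ?thesis using fc[OF pc rc q] by blast
    qed (use q in simp)
  qed
  then show thesis using that gs AS by blast
qed

lemma sign_face_bij: "bij_betw (sign_face d) (signs d) {A. A face_of unit_cube d \<and> A \<noteq> {}}"
proof (rule bij_betw_imageI)
  show "inj_on (sign_face d) (signs d)"
    by (rule inj_onI) (metis sign_le_antisym sign_face_subset_iff subset_refl)
  show "sign_face d ` signs d = {A. A face_of unit_cube d \<and> A \<noteq> {}}"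
  proof (intro equalityI subsetI)
    fix A assume "A \<in> sign_face d ` signs d"
    then obtain g where g: "g \<in> signs d" "A = sign_face d g" by blast
    then have "A \<noteq> {}" using sign_face_center[OF g(1)] by blast
    then show "A \<in> {A. A face_of unit_cube d \<and> A \<noteq> {}}" using g sign_face_face_of by blast
  next
    fix A assume "A \<in> {A. A face_of unit_cube d \<and> A \<noteq> {}}"
    then obtain g where "g \<in> signs d" "A = sign_face d g"
      using face_of_unit_cube_is_sign_face[of A d] by blast
    then show "A \<in> sign_face d ` signs d" by blast
  qed
qed

text \<open>Each free coordinate may be set to 0, set to 1 or left free; all other coordinates are
  forced.\<close>

lemma card_signs_below:
  assumes "g \<in> signs d"
  shows "card {g' \<in> signs d. sign_le d g' g} = 3 ^ card (free_coords d g)"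
proof -
  have "{g' \<in> signs d. sign_le d g' g} = PiE {..<d} (\<lambda>i. if g i = 2 then {0,1,2} else {g i})"
  proof (intro equalityI subsetI)
    fix f assume f: "f \<in> {g' \<in> signs d. sign_le d g' g}"
    then have "f i \<in> (if g i = 2 then {0,1,2} else {g i})" if "i < d" for i
      using that signs_values[of f d i] by (auto simp: sign_le_def)
    then show "f \<in> PiE {..<d} (\<lambda>i. if g i = 2 then {0,1,2} else {g i})"
      using f by (auto simp: signs_def PiE_iff)
  next
    fix f assume f: "f \<in> PiE {..<d} (\<lambda>i. if g i = 2 then {0,1,2} else {g i})"
    have g: "g i \<in> {0,1,2}" if "i < d" for i
      using assms that by (rule signs_values)
    have fi: "f i \<in> (if g i = 2 then {0,1,2} else {g i})" if "i < d" for i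
      using PiE_mem[OF f] that by simp
    have "f i \<in> {0,1,2} \<and> (g i = 2 \<or> g i = f i)" if "i < d" for i
      using g[OF that] fi[OF that] by (cases "g i = 2") simp_all
    then show "f \<in> {g' \<in> signs d. sign_le d g' g}"
      using f by (simp add: signs_def sign_le_def PiE_iff)
  qed
  then have "card {g' \<in> signs d. sign_le d g' g} = (\<Prod>i<d. if g i = 2 then 3 else 1)"
    by (simp add: card_PiE) (rule prod.cong, auto)
  also have "\<dots> = (\<Prod>i\<in>free_coords d g. 3)"
    by (rule prod.mono_neutral_cong_right) (auto simp: free_coords_def)
  finally show ?thesis by simp
qed

lemma sign_le_free_coords_mono:
  "sign_le d g g' \<Longrightarrow> g \<in> signs d \<Longrightarrow> g' \<in> signs d \<Longrightarrow> free_coords d g \<subseteq> free_coords d g'"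
  unfolding sign_le_def free_coords_def by (smt (verit) Collect_mono_iff)

text \<open>Above a fixed face, a face of the cube is determined by its additional free coordinates, so
  the interval is Boolean.\<close>

lemma signs_interval:
  assumes "g \<in> signs d" "h \<in> signs d" "sign_le d g h"
  shows "bij_betw (\<lambda>f. free_coords d f - free_coords d g)
           {f \<in> signs d. sign_le d g f \<and> sign_le d f h} (Pow (free_coords d h - free_coords d g))"
proof (rule bij_betw_byWitness[where f' = "\<lambda>T i. if i \<in> T then 2 else g i"])
  have "(\<lambda>i. if i \<in> T then 2 else g i) \<in> signs d \<and> sign_le d g (\<lambda>i. if i \<in> T then 2 else g i) \<and>
    sign_le d (\<lambda>i. if i \<in> T then 2 else g i) h" if "T \<subseteq> free_coords d h - free_coords d g" for T
    using that assms by (fastforce simp: signs_def sign_le_def free_coords_def PiE_iff extensional_def)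
  then show "(\<lambda>T i. if i \<in> T then 2 else g i) ` Pow (free_coords d h - free_coords d g)
      \<subseteq> {f \<in> signs d. sign_le d g f \<and> sign_le d f h}" by blast
  show "\<forall>f\<in>{f \<in> signs d. sign_le d g f \<and> sign_le d f h}.
      (\<lambda>i. if i \<in> free_coords d f - free_coords d g then 2 else g i) = f"
  proof
    fix f assume f: "f \<in> {f \<in> signs d. sign_le d g f \<and> sign_le d f h}"
    show "(\<lambda>i. if i \<in> free_coords d f - free_coords d g then 2 else g i) = f"
    proof
      fix i show "(if i \<in> free_coords d f - free_coords d g then 2 else g i) = f i"
        using f assms by (cases "i < d") (auto simp: signs_def sign_le_def free_coords_def PiE_iff extensional_def)
    qed
  qed
  show "\<forall>T\<in>Pow (free_coords d h - free_coords d g).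
      free_coords d (\<lambda>i. if i \<in> T then 2 else g i) - free_coords d g = T"
    by (auto simp: free_coords_def split: if_splits)
  show "(\<lambda>f. free_coords d f - free_coords d g) ` {f \<in> signs d. sign_le d g f \<and> sign_le d f h}
      \<subseteq> Pow (free_coords d h - free_coords d g)"
    using assms sign_le_free_coords_mono by fastforce
qed

section \<open>Cubical complexes\<close>

lemma card_signs: "card (signs d) = 3 ^ d"
  by (simp add: signs_def card_PiE eval_nat_numeral)

text \<open>An order isomorphism must send the minimum to the empty face of the cube. Removing both
  leaves exactly the faces that sign vectors describe.\<close>

lemma abstract_cube_signs:
  assumes r: "abstract_cube k r" and b: "is_minimum r b"
  obtains \<gamma> where "bij_betw \<gamma> (Field r - {b}) (signs k)"
    "\<And>F G. F \<in> Field r - {b} \<Longrightarrow> G \<in> Field r - {b} \<Longrightarrow> (F, G) \<in> r \<longleftrightarrow> sign_le k (\<gamma> F) (\<gamma> G)"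
proof -
  obtain f where f: "bij_betw f (Field r) (Field (cube_face_poset k))"
    and ord: "\<And>F G. F \<in> Field r \<Longrightarrow> G \<in> Field r \<Longrightarrow> (F, G) \<in> r \<longleftrightarrow> (f F, f G) \<in> cube_face_poset k"
    using r unfolding abstract_cube_def iso_iff2 by blast
  have fld: "Field (cube_face_poset k) = {A. A face_of unit_cube k}"
    by (auto simp: cube_face_poset_def Field_def)
  have "{} \<in> Field (cube_face_poset k)" by (simp add: fld)
  then obtain z where z: "z \<in> Field r" "f z = {}"
    using f by (metis bij_betw_imp_surj_on imageE)
  have b': "b \<in> Field r" "(b, z) \<in> r" using b z by (auto simp: is_minimum_def)
  then have fb: "f b = {}" using ord[of b z] z by (auto simp: cube_face_poset_def)
  have "bij_betw f (Field r - {b}) (Field (cube_face_poset k) - {f b})"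
    using f b'(1) bij_betwE[OF f] by (intro bij_betw_DiffI) auto
  then have f': "bij_betw f (Field r - {b}) {A. A face_of unit_cube k \<and> A \<noteq> {}}"
    by (simp add: fld fb set_diff_eq)
  define u where "u = inv_into (signs k) (sign_face k)"
  have u: "bij_betw u {A. A face_of unit_cube k \<and> A \<noteq> {}} (signs k)"
    unfolding u_def by (rule bij_betw_inv_into[OF sign_face_bij])
  have bij: "bij_betw (u \<circ> f) (Field r - {b}) (signs k)"
    by (rule bij_betw_trans[OF f' u])
  have su: "sign_face k (u A) = A" if "A face_of unit_cube k" "A \<noteq> {}" for A
    unfolding u_def using bij_betw_inv_into_right[OF sign_face_bij] that by blast
  have "(F, G) \<in> r \<longleftrightarrow> sign_le k ((u \<circ> f) F) ((u \<circ> f) G)"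
    if FG: "F \<in> Field r - {b}" "G \<in> Field r - {b}" for F G
  proof -
    have fF: "f F face_of unit_cube k" "f F \<noteq> {}" "f G face_of unit_cube k" "f G \<noteq> {}"
      using bij_betwE[OF f'] FG by blast+
    have "(F, G) \<in> r \<longleftrightarrow> f F \<subseteq> f G"
      using ord FG fF by (simp add: cube_face_poset_def)
    also have "\<dots> \<longleftrightarrow> sign_face k (u (f F)) \<subseteq> sign_face k (u (f G))"
      using su fF by simp
    also have "\<dots> \<longleftrightarrow> sign_le k (u (f F)) (u (f G))"
      using bij_betwE[OF u] fF by (intro sign_face_subset_iff) auto
    finally show ?thesis by simp
  qed
  then show thesis using that bij by blast
qed

section \<open>Order structure of a cubical complex and sign coordinates below a face\<close>

locale cubical =
  fixes K :: "'a rel"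
  assumes complex: "cubical_complex K"
begin

lemma finite_Field: "finite (Field K)"
  using complex by (simp add: cubical_complex_def)

lemma finite_faces: "finite (faces K)"
  using finite_Field by (simp add: faces_def)

lemma Field_le: "(F, G) \<in> K \<Longrightarrow> F \<in> Field K" "(F, G) \<in> K \<Longrightarrow> G \<in> Field K"
  by (auto simp: Field_def)

lemma le_refl: "F \<in> Field K \<Longrightarrow> (F, F) \<in> K"
  using complex
  by (auto simp: cubical_complex_def partial_order_on_def preorder_on_def refl_on_def)

lemma le_trans: "(F, G) \<in> K \<Longrightarrow> (G, H) \<in> K \<Longrightarrow> (F, H) \<in> K"
  using complex
  by (auto simp: cubical_complex_def partial_order_on_def preorder_on_def dest: transD)

lemma le_antisym: "(F, G) \<in> K \<Longrightarrow> (G, F) \<in> K \<Longrightarrow> F = G"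
  using complex by (auto simp: cubical_complex_def partial_order_on_def dest: antisymD)

lemma empty_face_eqI: "is_minimum K b \<Longrightarrow> empty_face K = b"
  unfolding empty_face_def using le_antisym by (intro the_equality) (auto simp: is_minimum_def)

lemma is_minimum_empty_face: "is_minimum K (empty_face K)"
  using complex empty_face_eqI by (metis cubical_complex_def)

lemma empty_face_le: "F \<in> Field K \<Longrightarrow> (empty_face K, F) \<in> K"
  using is_minimum_empty_face by (simp add: is_minimum_def)

lemma empty_face_in_Field: "empty_face K \<in> Field K"
  using is_minimum_empty_face by (simp add: is_minimum_def)

lemma faces_in_Field: "F \<in> faces K \<Longrightarrow> F \<in> Field K"
  by (simp add: faces_def)

lemma faces_above: "F \<in> faces K \<Longrightarrow> (F, G) \<in> K \<Longrightarrow> G \<in> faces K"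
  using empty_face_le le_antisym Field_le by (auto simp: faces_def)

lemma Field_Restr_ideal:
  assumes "ofilter K A" shows "Field (Restr K A) = A"
proof
  show "A \<subseteq> Field (Restr K A)"
    using assms le_refl by (intro subsetI FieldI1) (auto simp: ofilter_def)
qed (auto simp: Field_def)

lemma Partial_order_Restr_ideal: "Partial_order (Restr K A)"
  using complex by (simp add: cubical_complex_def Partial_order_Restr)

lemma ofilter_under: "ofilter K (under K F)"
  using le_trans Field_le by (auto simp: ofilter_def under_def)

text \<open>A single chart at \<open>H\<close> serves all faces below \<open>H\<close>: their order,
  dimensions and intervals can be read off in the same coordinates.\<close>

definition sign_chart :: "'a \<Rightarrow> nat \<Rightarrow> ('a \<Rightarrow> nat \<Rightarrow> nat) \<Rightarrow> bool" where
  "sign_chart H k \<gamma> \<longleftrightarrow>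
     bij_betw \<gamma> {F \<in> faces K. (F, H) \<in> K} (signs k) \<and>
     (\<forall>F\<in>faces K. \<forall>G\<in>faces K. (F, H) \<in> K \<longrightarrow> (G, H) \<in> K \<longrightarrow>
        ((F, G) \<in> K \<longleftrightarrow> sign_le k (\<gamma> F) (\<gamma> G)))"

lemma sign_chart_bij: "sign_chart H k \<gamma> \<Longrightarrow> bij_betw \<gamma> {F \<in> faces K. (F, H) \<in> K} (signs k)"
  by (simp add: sign_chart_def)

lemma sign_chart_signs:
  "sign_chart H k \<gamma> \<Longrightarrow> F \<in> faces K \<Longrightarrow> (F, H) \<in> K \<Longrightarrow> \<gamma> F \<in> signs k"
  using bij_betwE[OF sign_chart_bij] by blast

lemma sign_chart_le_iff:
  "sign_chart H k \<gamma> \<Longrightarrow> F \<in> faces K \<Longrightarrow> G \<in> faces K \<Longrightarrow> (F, H) \<in> K \<Longrightarrow> (G, H) \<in> K \<Longrightarrow>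
    (F, G) \<in> K \<longleftrightarrow> sign_le k (\<gamma> F) (\<gamma> G)"
  by (simp add: sign_chart_def)

lemma sign_chart_surj:
  assumes "sign_chart H k \<gamma>" "g \<in> signs k"
  obtains F where "F \<in> faces K" "(F, H) \<in> K" "\<gamma> F = g"
proof -
  have "g \<in> \<gamma> ` {F \<in> faces K. (F, H) \<in> K}"
    using bij_betw_imp_surj_on[OF sign_chart_bij[OF assms(1)]] assms(2) by simp
  then obtain F where "g = \<gamma> F" "F \<in> {F \<in> faces K. (F, H) \<in> K}" by (rule imageE)
  then show thesis by (intro that[of F]) simp_all
qed

lemma sign_chart_exists:
  assumes H: "H \<in> faces K" and k: "abstract_cube k (Restr K (under K H))"
  shows "\<exists>\<gamma>. sign_chart H k \<gamma>"
proof -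
  have fld: "Field (Restr K (under K H)) = under K H"
    by (rule Field_Restr_ideal[OF ofilter_under])
  have "is_minimum (Restr K (under K H)) (empty_face K)"
    unfolding is_minimum_def fld using H faces_in_Field empty_face_le Field_le
    by (auto simp: under_def)
  from abstract_cube_signs[OF k this] obtain \<gamma> where
    \<gamma>: "bij_betw \<gamma> (under K H - {empty_face K}) (signs k)"
    "\<And>F G. F \<in> under K H - {empty_face K} \<Longrightarrow> G \<in> under K H - {empty_face K} \<Longrightarrow>
      (F, G) \<in> Restr K (under K H) \<longleftrightarrow> sign_le k (\<gamma> F) (\<gamma> G)"
    unfolding fld by blast
  have eq: "under K H - {empty_face K} = {F \<in> faces K. (F, H) \<in> K}"
    using Field_le by (auto simp: under_def faces_def)
  show ?thesis
    using \<gamma> unfolding eq sign_chart_def by (intro exI[of _ \<gamma>]) (auto simp: under_def)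
qed

lemma faces_cube: "F \<in> faces K \<Longrightarrow> \<exists>k. abstract_cube k (Restr K (under K F))"
  using complex by (simp add: cubical_complex_def)

lemma card_faces_below:
  assumes "H \<in> faces K" "abstract_cube k (Restr K (under K H))"
  shows "card {F \<in> faces K. (F, H) \<in> K} = 3 ^ k"
  using sign_chart_exists[OF assms] bij_betw_same_card[OF sign_chart_bij] card_signs by metis

text \<open>The number of faces \<open>3 ^ k\<close> identifies the dimension of a cube.\<close>

lemma face_dim_eqI:
  assumes F: "F \<in> faces K" and "card {G \<in> faces K. (G, F) \<in> K} = 3 ^ k"
  shows "face_dim K F = int k"
proof -
  have "j = k" if "abstract_cube j (Restr K (under K F))" for j
    using card_faces_below[OF F that] assms(2) by simp
  then have "(THE j. abstract_cube j (Restr K (under K F))) = k"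
    using faces_cube[OF F] by (intro the_equality) auto
  then show ?thesis using F by (simp add: face_dim_def faces_def)
qed

text \<open>Counting the sign vectors below \<open>\<gamma> F\<close> gives the dimension of
  \<open>F\<close> without comparing the chart at \<open>H\<close> with one at
  \<open>F\<close>.\<close>

lemma face_dim_sign_chart:
  assumes \<gamma>: "sign_chart H k \<gamma>" and F: "F \<in> faces K" "(F, H) \<in> K"
  shows "face_dim K F = int (card (free_coords k (\<gamma> F)))"
proof (rule face_dim_eqI[OF F(1)])
  have "\<gamma> ` {G \<in> faces K. (G, F) \<in> K} = {g \<in> signs k. sign_le k g (\<gamma> F)}"
  proof (intro equalityI subsetI)
    fix g assume "g \<in> \<gamma> ` {G \<in> faces K. (G, F) \<in> K}"
    then obtain G where G: "g = \<gamma> G" "G \<in> faces K" "(G, F) \<in> K" by blast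
    then have "(G, H) \<in> K" using le_trans F(2) by blast
    then show "g \<in> {g \<in> signs k. sign_le k g (\<gamma> F)}"
      using G F sign_chart_le_iff[OF \<gamma>] sign_chart_signs[OF \<gamma>] by simp
  next
    fix g assume g: "g \<in> {g \<in> signs k. sign_le k g (\<gamma> F)}"
    then obtain G where "G \<in> faces K" "(G, H) \<in> K" "\<gamma> G = g"
      using sign_chart_surj[OF \<gamma>] by blast
    then show "g \<in> \<gamma> ` {G \<in> faces K. (G, F) \<in> K}"
      using g F sign_chart_le_iff[OF \<gamma>] by (intro image_eqI[of _ _ G]) auto
  qed
  moreover have "inj_on \<gamma> {G \<in> faces K. (G, F) \<in> K}"
    using bij_betw_imp_inj_on[OF sign_chart_bij[OF \<gamma>]]
    by (rule inj_on_subset) (use F(2) le_trans in blast)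
  ultimately have "card {G \<in> faces K. (G, F) \<in> K} = card {g \<in> signs k. sign_le k g (\<gamma> F)}"
    using card_image[of \<gamma> "{G \<in> faces K. (G, F) \<in> K}"] by simp
  also have "\<dots> = 3 ^ card (free_coords k (\<gamma> F))"
    by (intro card_signs_below sign_chart_signs[OF \<gamma>] F)
  finally show "card {G \<in> faces K. (G, F) \<in> K} = 3 ^ card (free_coords k (\<gamma> F))" .
qed

section \<open>Intervals of nonempty faces and their rank sums\<close>

lemma face_dim_nonneg: "F \<in> faces K \<Longrightarrow> 0 \<le> face_dim K F"
  by (simp add: face_dim_def faces_def)

lemma face_dim_empty_face: "face_dim K (empty_face K) = -1"
  by (simp add: face_dim_def)

text \<open>A chart at \<open>H\<close> transports the Boolean intervals of sign vectors to the
  complex. Only a finite set and cardinalities remain visible, so later sums need no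
  coordinates.\<close>

lemma interval_Boolean:
  assumes G: "G \<in> faces K" and GH: "(G, H) \<in> K"
  obtains b :: "'a \<Rightarrow> nat set" and S where "finite S"
    "bij_betw b {F \<in> faces K. (G, F) \<in> K \<and> (F, H) \<in> K} (Pow S)"
    "\<forall>F. (G, F) \<in> K \<longrightarrow> (F, H) \<in> K \<longrightarrow> face_dim K F = face_dim K G + int (card (b F))"
    "face_dim K H = face_dim K G + int (card S)"
proof -
  have H: "H \<in> faces K" using faces_above[OF G GH] .
  obtain k \<gamma> where \<gamma>: "sign_chart H k \<gamma>"
    using sign_chart_exists[OF H] faces_cube[OF H] by blast
  note ord = sign_chart_le_iff[OF \<gamma>] and \<gamma>s = sign_chart_signs[OF \<gamma>]
    and dim = face_dim_sign_chart[OF \<gamma>]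
  have HH: "(H, H) \<in> K" using H le_refl faces_in_Field by blast
  define b where "b = (\<lambda>F. free_coords k (\<gamma> F) - free_coords k (\<gamma> G))"
  define S where "S = b H"
  let ?I = "{F \<in> faces K. (G, F) \<in> K \<and> (F, H) \<in> K}"
  have img: "\<gamma> ` ?I = {f \<in> signs k. sign_le k (\<gamma> G) f \<and> sign_le k f (\<gamma> H)}"
  proof (intro equalityI subsetI)
    fix f assume f: "f \<in> {f \<in> signs k. sign_le k (\<gamma> G) f \<and> sign_le k f (\<gamma> H)}"
    then obtain F where "F \<in> faces K" "(F, H) \<in> K" "\<gamma> F = f"
      using sign_chart_surj[OF \<gamma>] by blast
    then show "f \<in> \<gamma> ` ?I" using f ord G GH by (intro image_eqI[of _ _ F]) auto
  next
    fix f assume "f \<in> \<gamma> ` ?I"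
    then obtain F where "F \<in> faces K" "(G, F) \<in> K" "(F, H) \<in> K" "f = \<gamma> F" by blast
    then show "f \<in> {f \<in> signs k. sign_le k (\<gamma> G) f \<and> sign_le k f (\<gamma> H)}"
      using ord[of G F] ord[of F H] \<gamma>s[of F] G GH H HH by simp
  qed
  have "bij_betw \<gamma> ?I {f \<in> signs k. sign_le k (\<gamma> G) f \<and> sign_le k f (\<gamma> H)}"
    using img by (intro bij_betw_imageI inj_on_subset[OF bij_betw_imp_inj_on[OF sign_chart_bij[OF \<gamma>]]]) auto
  from bij_betw_trans[OF this signs_interval]
  have bij: "bij_betw b ?I (Pow S)"
    using \<gamma>s G GH H HH ord[of G H] by (simp add: comp_def b_def S_def)
  have bdim: "face_dim K F = face_dim K G + int (card (b F))" if "(G, F) \<in> K" "(F, H) \<in> K" for F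
  proof -
    have F: "F \<in> faces K" using faces_above G that by blast
    have "free_coords k (\<gamma> G) \<subseteq> free_coords k (\<gamma> F)"
      using ord[of G F] G F GH that \<gamma>s by (intro sign_le_free_coords_mono) auto
    then show ?thesis
      using dim[OF F that(2)] dim[OF G GH] unfolding b_def
      by (simp add: card_Diff_subset card_mono of_nat_diff)
  qed
  show thesis
    by (rule that[OF _ bij]) (use bdim bdim[OF GH HH] in \<open>auto simp: S_def b_def\<close>)
qed

text \<open>This is the expansion of a product of factors \<open>a + c\<close> over the atoms of the
  Boolean interval: each subset takes \<open>a\<close> on its elements and \<open>c\<close>
  elsewhere. It is used with \<open>a = -1\<close>, \<open>c = x\<close> and with
  \<open>a = 1\<close>, \<open>c = -1\<close>.\<close>

lemma sum_interval:
  fixes a c :: "'b::comm_ring_1"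
  assumes G: "G \<in> faces K" and GH: "(G, H) \<in> K"
  shows "(\<Sum>F\<in>{F \<in> faces K. (G, F) \<in> K \<and> (F, H) \<in> K}.
            a ^ nat (face_dim K F - face_dim K G) * c ^ nat (face_dim K H - face_dim K F))
          = (a + c) ^ nat (face_dim K H - face_dim K G)"
proof -
  obtain b :: "'a \<Rightarrow> nat set" and S where S: "finite S"
    "bij_betw b {F \<in> faces K. (G, F) \<in> K \<and> (F, H) \<in> K} (Pow S)"
    and dim: "\<forall>F. (G, F) \<in> K \<longrightarrow> (F, H) \<in> K \<longrightarrow> face_dim K F = face_dim K G + int (card (b F))"
    "face_dim K H = face_dim K G + int (card S)"
    by (rule interval_Boolean[OF G GH])
  let ?I = "{F \<in> faces K. (G, F) \<in> K \<and> (F, H) \<in> K}"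
  have "(\<Sum>F\<in>?I. a ^ nat (face_dim K F - face_dim K G) * c ^ nat (face_dim K H - face_dim K F))
      = (\<Sum>F\<in>?I. (\<Prod>i\<in>b F. a) * (\<Prod>i\<in>S - b F. c))"
  proof (rule sum.cong[OF refl])
    fix F assume F: "F \<in> ?I"
    then have bF: "b F \<subseteq> S" using bij_betwE[OF S(2)] by blast
    then have "card (S - b F) = card S - card (b F)" "card (b F) \<le> card S"
      using S(1) by (auto simp: card_Diff_subset finite_subset card_mono)
    then show "a ^ nat (face_dim K F - face_dim K G) * c ^ nat (face_dim K H - face_dim K F)
        = (\<Prod>i\<in>b F. a) * (\<Prod>i\<in>S - b F. c)"
      using dim(1)[rule_format, of F] dim(2) F by (simp add: nat_diff_distrib)
  qed
  also have "\<dots> = (\<Sum>T\<in>Pow S. (\<Prod>i\<in>T. a) * (\<Prod>i\<in>S - T. c))"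
    by (rule sum.reindex_bij_betw[OF S(2)])
  also have "\<dots> = (\<Prod>i\<in>S. a + c)"
    by (rule prod_add[OF S(1), symmetric])
  finally show ?thesis using dim(2) by simp
qed

lemma face_dim_mono: "F \<in> faces K \<Longrightarrow> (F, G) \<in> K \<Longrightarrow> face_dim K F \<le> face_dim K G"
  by (rule interval_Boolean[of F G]) auto

text \<open>The Boolean interval has rank 0, hence a single element. Dimension is therefore
  injective on chains, which bounds their length.\<close>

lemma face_dim_eq_imp_eq:
  assumes F: "F \<in> faces K" and FG: "(F, G) \<in> K" and eq: "face_dim K F = face_dim K G"
  shows "F = G"
proof -
  have FF: "(F, F) \<in> K" "(G, G) \<in> K" using F FG le_refl Field_le by blast+
  obtain b :: "'a \<Rightarrow> nat set" and S where S: "finite S"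
    "bij_betw b {E \<in> faces K. (F, E) \<in> K \<and> (E, G) \<in> K} (Pow S)"
    "\<forall>E. (F, E) \<in> K \<longrightarrow> (E, G) \<in> K \<longrightarrow> face_dim K E = face_dim K F + int (card (b E))"
    and dim: "face_dim K G = face_dim K F + int (card S)"
    by (rule interval_Boolean[OF F FG])
  have "S = {}" using dim eq S(1) by simp
  then have "b F = {}" "b G = {}"
    using bij_betwE[OF S(2)] F FG FF faces_above by blast+
  then show ?thesis
    using bij_betw_imp_inj_on[OF S(2)] F FG FF faces_above by (metis (mono_tags, lifting) inj_onD mem_Collect_eq)
qed

section \<open>Longest chains of faces and the dimension of a ball\<close>

lemma facet_exists:
  assumes H: "H \<in> faces K" and pos: "0 < face_dim K H"
  obtains F where "F \<in> faces K" "(F, H) \<in> K" "face_dim K F = face_dim K H - 1"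
proof -
  obtain k \<gamma> where \<gamma>: "sign_chart H k \<gamma>"
    using sign_chart_exists[OF H] faces_cube[OF H] by blast
  note dim = face_dim_sign_chart[OF \<gamma>]
  have HH: "(H, H) \<in> K" using H le_refl faces_in_Field by blast
  have "free_coords k (\<gamma> H) \<noteq> {}" using dim[OF H HH] pos by auto
  then obtain i where i: "i \<in> free_coords k (\<gamma> H)" by blast
  \<comment> \<open>Fixing one free coordinate at an endpoint gives a facet.\<close>
  have "(\<gamma> H)(i := 0) \<in> signs k"
    using sign_chart_signs[OF \<gamma> H HH] i
    by (auto simp: signs_def free_coords_def PiE_iff extensional_def)
  then obtain F where F: "F \<in> faces K" "(F, H) \<in> K" "\<gamma> F = (\<gamma> H)(i := 0)"
    using sign_chart_surj[OF \<gamma>] by blast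
  have "free_coords k ((\<gamma> H)(i := 0)) = free_coords k (\<gamma> H) - {i}"
    by (auto simp: free_coords_def)
  moreover have "Suc (card (free_coords k (\<gamma> H) - {i})) = card (free_coords k (\<gamma> H))"
    using i by (intro card_Suc_Diff1) simp
  ultimately have "face_dim K F = face_dim K H - 1"
    using dim[OF F(1,2)] dim[OF H HH] F(3) by simp
  then show thesis using that F by blast
qed

text \<open>Descending through facets meets every dimension from \<open>face_dim K H\<close> to 0,
  which accounts for the successor.\<close>

lemma chain_below_face:
  assumes "H \<in> faces K"
  shows "\<exists>C\<subseteq>faces K. C \<in> Chains K \<and> (\<forall>F\<in>C. (F, H) \<in> K) \<and> card C = Suc (nat (face_dim K H))"
  using assms
proof (induction "nat (face_dim K H)" arbitrary: H)
  case 0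
  then have "(H, H) \<in> K" using le_refl faces_in_Field by blast
  then show ?case using 0 by (intro exI[of _ "{H}"]) (auto simp: Chains_def)
next
  case (Suc n)
  have HH: "(H, H) \<in> K" using Suc le_refl faces_in_Field by blast
  have "0 < face_dim K H" using Suc.hyps(2) by simp
  then obtain F where F: "F \<in> faces K" "(F, H) \<in> K" "face_dim K F = face_dim K H - 1"
    using facet_exists Suc.prems by blast
  then have n: "n = nat (face_dim K F)" using Suc.hyps(2) by simp
  obtain C where C: "C \<subseteq> faces K" "C \<in> Chains K" "\<forall>F'\<in>C. (F', F) \<in> K" "card C = Suc (nat (face_dim K F))"
    using Suc.hyps(1)[OF n F(1)] by blast
  have CH: "\<forall>F'\<in>C. (F', H) \<in> K" using C(3) F(2) le_trans by blast
  have "H \<notin> C" using C(3) F le_antisym by fastforce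
  then have "card (insert H C) = Suc (nat (face_dim K H))"
    using C finite_subset[OF C(1) finite_faces] n Suc.hyps(2) by simp
  moreover have "insert H C \<in> Chains K" using C(2) CH HH by (auto simp: Chains_def)
  ultimately show ?case using C(1) CH HH Suc.prems by (intro exI[of _ "insert H C"]) auto
qed

lemma face_dim_le_complex_dim: "F \<in> Field K \<Longrightarrow> face_dim K F \<le> complex_dim K"
  unfolding complex_dim_def using finite_Field by (simp add: Max_ge)

lemma complex_dim_attained:
  assumes "faces K \<noteq> {}"
  obtains H where "H \<in> faces K" "face_dim K H = complex_dim K"
proof -
  obtain F where F: "F \<in> faces K" using assms by blast
  have "complex_dim K \<in> face_dim K ` Field K"
    unfolding complex_dim_def using finite_Field F faces_in_Field by (intro Max_in) auto
  then obtain H where H: "H \<in> Field K" "face_dim K H = complex_dim K" by auto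
  have "0 \<le> complex_dim K"
    using face_dim_nonneg[OF F] face_dim_le_complex_dim[OF faces_in_Field[OF F]] by simp
  then have "H \<noteq> empty_face K" using H(2) face_dim_empty_face by auto
  then show thesis using that H by (simp add: faces_def)
qed

text \<open>A chain of nonempty faces has distinct dimensions between 0 and
  \<open>complex_dim K\<close>, and some chain attains all of them. So the longest chains have
  \<open>complex_dim K + 1\<close> elements, and the topological lemma applies.\<close>

lemma complex_dim_ball:
  assumes "is_ball n K"
  shows "complex_dim K = int n"
proof -
  let ?r = "Restr K (faces K)"
  have fld: "Field ?r = faces K"
  proof
    show "faces K \<subseteq> Field ?r"
      using le_refl faces_in_Field by (intro subsetI FieldI1) auto
  qed (auto simp: Field_def)
  have hom: "complex_space K homeomorphic_space ball_space n"
    using assms by (simp add: is_ball_def)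
  \<comment> \<open>The ball contains its center, even for \<open>n = 0\<close>. A complex without
    nonempty faces has no points, since its weights would sum to 0 instead of 1.\<close>
  have "(\<lambda>_. 0) \<in> topspace (ball_space n)"
    by (simp add: ball_space_def topspace_Euclidean_space)
  then have "topspace (ball_space n) \<noteq> {}" by blast
  then have "topspace (complex_space K) \<noteq> {}"
    using homeomorphic_empty_space[OF hom] by (metis null_topspace_iff_trivial)
  then have "complex_points K \<noteq> {}" by (auto simp: complex_space_def)
  then have ne: "faces K \<noteq> {}"
    unfolding complex_points_def order_complex_points_def fld by auto
  obtain H where H: "H \<in> faces K" "face_dim K H = complex_dim K"
    using complex_dim_attained[OF ne] by blast
  obtain C where C: "C \<subseteq> faces K" "C \<in> Chains K" "card C = Suc (nat (complex_dim K))"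
    using chain_below_face[OF H(1)] H(2) by auto
  have nonneg: "0 \<le> complex_dim K" using face_dim_nonneg[OF H(1)] H(2) by simp
  have "nat (complex_dim K) = n"
  proof (rule order_complex_ball_imp_chain_card)
    show "finite (Field ?r)" using fld finite_faces by simp
    show "C \<in> Chains ?r" using C(1,2) by (auto simp: Chains_def)
    show "card C = Suc (nat (complex_dim K))" by fact
    show "subtopology (powertop_real UNIV) (order_complex_points ?r) homeomorphic_space ball_space n"
      using hom by (simp add: complex_space_def complex_points_def)
    fix D assume D: "D \<in> Chains ?r"
    then have Df: "D \<subseteq> faces K" by (auto simp: Chains_def)
    have "inj_on (face_dim K) D"
    proof (rule inj_onI)
      fix F G assume FG: "F \<in> D" "G \<in> D" "face_dim K F = face_dim K G"
      then have "(F, G) \<in> K \<or> (G, F) \<in> K" using D by (auto simp: Chains_def)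
      then show "F = G" using face_dim_eq_imp_eq FG Df by (metis subsetD)
    qed
    moreover have "face_dim K ` D \<subseteq> {0..complex_dim K}"
      using Df face_dim_nonneg face_dim_le_complex_dim faces_in_Field by fastforce
    ultimately have "card D \<le> card {0..complex_dim K}"
      by (intro card_inj_on_le) auto
    then show "card D \<le> Suc (nat (complex_dim K))" using nonneg by (simp add: nat_add_distrib)
  qed
  then show ?thesis using nonneg by simp
qed

section \<open>Subcomplexes as cubical complexes\<close>

lemma Restr_under_ideal:
  assumes "ofilter K A" "F \<in> A"
  shows "Restr (Restr K A) (under (Restr K A) F) = Restr K (under K F)"
proof -
  have "under (Restr K A) F = under K F" "under K F \<subseteq> A"
    using assms by (auto simp: ofilter_def under_def)
  then show ?thesis by auto
qed

text \<open>An order ideal contains the whole interval below each of its elements, so cubes,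
  dimensions and greatest lower bounds are inherited. This allows the ball lemma to be applied to
  the restrictions of \<open>K'\<close>.\<close>

lemma subcomplex_facts:
  assumes A: "subcomplex K A"
  shows "cubical_complex (Restr K A)" "empty_face (Restr K A) = empty_face K"
    "faces (Restr K A) = A \<inter> faces K"
    "\<And>F. F \<in> A \<Longrightarrow> face_dim (Restr K A) F = face_dim K F"
proof -
  have of: "ofilter K A" and ne: "A \<noteq> {}" using A by (auto simp: subcomplex_def)
  have fld: "Field (Restr K A) = A" by (rule Field_Restr_ideal[OF of])
  have AF: "A \<subseteq> Field K" and down: "\<And>F G. G \<in> A \<Longrightarrow> (F, G) \<in> K \<Longrightarrow> F \<in> A"
    using of by (auto simp: ofilter_def under_def)
  have eA: "empty_face K \<in> A" using ne AF down empty_face_le by blast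
  have min: "is_minimum (Restr K A) (empty_face K)"
    unfolding is_minimum_def fld using eA AF empty_face_le by auto
  have po: "Partial_order (Restr K A)" by (rule Partial_order_Restr_ideal)
  have "b = empty_face K" if "is_minimum (Restr K A) b" for b
    using that min le_antisym unfolding is_minimum_def by blast
  with min show ef: "empty_face (Restr K A) = empty_face K"
    unfolding empty_face_def[of "Restr K A"] by (intro the_equality)
  show fc: "faces (Restr K A) = A \<inter> faces K"
    using AF by (auto simp: faces_def ef fld)
  show "\<And>F. F \<in> A \<Longrightarrow> face_dim (Restr K A) F = face_dim K F"
    unfolding face_dim_def ef using Restr_under_ideal[OF of] by simp
  show "cubical_complex (Restr K A)"
    unfolding cubical_complex_def
  proof (intro conjI ballI)
    show "finite (Field (Restr K A))" using fld AF finite_Field finite_subset by metis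
    show "Partial_order (Restr K A)" by fact
    show "\<exists>b. is_minimum (Restr K A) b" using min by blast
    show "\<exists>k. abstract_cube k (Restr (Restr K A) (under (Restr K A) F))"
      if "F \<in> faces (Restr K A)" for F
      using that faces_cube Restr_under_ideal[OF of] fc by auto
    show "\<exists>H. Defs.is_glb (Restr K A) F G H" if "F \<in> Field (Restr K A)" "G \<in> Field (Restr K A)" for F G
    proof -
      have FG: "F \<in> A" "G \<in> A" using that fld by auto
      then obtain H where "Defs.is_glb K F G H"
        using complex AF unfolding cubical_complex_def by blast
      then have "Defs.is_glb (Restr K A) F G H"
        using FG down unfolding Defs.is_glb_def by blast
      then show ?thesis by blast
    qed
  qed
qed

end

section \<open>The decomposition of the short cubical h-polynomial\<close>

text \<open>Here the dimension of the ball replaces \<open>complex_dim\<close> in the exponents. The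
  existence of a face of dimension \<open>n\<close> later shows that \<open>K'\<close> reaches the
  dimension of \<open>K\<close>.\<close>

lemma h_sc_subcomplex_ball:
  assumes K: "cubical_complex K" and A: "subcomplex K A" and ball: "is_ball n (Restr K A)"
  shows "h_sc (Restr K A) =
      (\<Sum>E\<in>A \<inter> faces K. [:0, 2:] ^ nat (face_dim K E) * [:1, -1:] ^ nat (int n - face_dim K E))"
    and "E \<in> A \<inter> faces K \<Longrightarrow> face_dim K E \<le> int n"
    and "\<exists>E\<in>A \<inter> faces K. face_dim K E = int n"
proof -
  interpret cubical K by unfold_locales fact
  interpret L: cubical "Restr K A" by unfold_locales (rule subcomplex_facts(1)[OF A])
  have fc: "faces (Restr K A) = A \<inter> faces K" by (rule subcomplex_facts(3)[OF A])
  have dim: "face_dim (Restr K A) E = face_dim K E" if "E \<in> A" for E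
    by (rule subcomplex_facts(4)[OF A that])
  have cd: "complex_dim (Restr K A) = int n" by (rule L.complex_dim_ball[OF ball])
  show "h_sc (Restr K A) =
      (\<Sum>E\<in>A \<inter> faces K. [:0, 2:] ^ nat (face_dim K E) * [:1, -1:] ^ nat (int n - face_dim K E))"
    unfolding h_sc_def fc cd by (rule sum.cong) (auto simp: dim)
  show "face_dim K E \<le> int n" if "E \<in> A \<inter> faces K"
    using L.face_dim_le_complex_dim[OF L.faces_in_Field, of E] that cd dim[of E] fc by simp
  have "faces (Restr K A) \<noteq> {}"
  proof
    assume e: "faces (Restr K A) = {}"
    then have "Field (Restr K A) = {empty_face (Restr K A)}"
      using L.empty_face_in_Field by (auto simp: faces_def)
    then have "complex_dim (Restr K A) = -1"
      by (simp add: complex_dim_def L.face_dim_empty_face)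
    then show False using cd by simp
  qed
  then obtain E where "E \<in> A \<inter> faces K" "face_dim (Restr K A) E = int n"
    using L.complex_dim_attained cd fc by metis
  then show "\<exists>E\<in>A \<inter> faces K. face_dim K E = int n" using dim by (intro bexI[of _ E]) auto
qed

theorem theorem4p1:
  fixes K :: "'a rel" and K' :: "'b rel" and \<sigma> :: "'b \<Rightarrow> 'a" and d :: int
  assumes "cubical_complex K"
    and "pure_complex K"
    and "complex_dim K = d"
    and "cubical_subdivision K K' \<sigma>"
  shows "h_sc K' = (\<Sum>F\<in>faces K. local_h K K' \<sigma> F * h_link d K F)"
proof -
  have K': "cubical_complex K'" and \<sigma>: "\<And>E. E \<in> faces K' \<Longrightarrow> \<sigma> E \<in> faces K"
    and sub: "\<And>F. F \<in> faces K \<Longrightarrow> subcomplex K' (restriction_faces K K' \<sigma> F)"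
    and ball: "\<And>F. F \<in> faces K \<Longrightarrow> is_ball (nat (face_dim K F)) (restriction K K' \<sigma> F)"
    using assms(4) by (auto simp: cubical_subdivision_def)
  interpret cubical K by unfold_locales fact
  interpret K': cubical K' by unfold_locales fact
  let ?X = "faces K" and ?X' = "faces K'"
  let ?n = "face_dim K" and ?n' = "face_dim K'"
  define q :: "int poly" where "q = [:1, -1:]"
  define x :: "int poly" where "x = [:0, 1:]"
  define y :: "int poly" where "y = [:0, 2:]"
  have rf: "restriction_faces K K' \<sigma> F \<inter> ?X' = {E \<in> ?X'. (\<sigma> E, F) \<in> K}" for F
    using \<sigma> by (auto simp: restriction_faces_def faces_def)
  have h_restr: "h_sc (restriction K K' \<sigma> G) =
      (\<Sum>E\<in>{E \<in> ?X'. (\<sigma> E, G) \<in> K}. y ^ nat (?n' E) * q ^ nat (?n G - ?n' E))"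
    and dim_le: "\<And>E. E \<in> ?X' \<Longrightarrow> (\<sigma> E, G) \<in> K \<Longrightarrow> ?n' E \<le> ?n G"
    and dim_eq: "\<exists>E\<in>?X'. ?n' E = ?n G"
    if G: "G \<in> ?X" for G
    using h_sc_subcomplex_ball[OF K' sub[OF G] ball[OF G, unfolded restriction_def]]
      face_dim_nonneg[OF G]
    by (auto simp: rf y_def q_def restriction_def)
  have dim_d: "?n F \<le> d" if "F \<in> ?X" for F
    using face_dim_le_complex_dim faces_in_Field assms(3) that by blast

  \<comment> \<open>A face \<open>E\<close> is bounded by the dimension of its carrier
    \<open>\<sigma> E\<close>; conversely, the restriction to a face of \<open>K\<close> of
    dimension \<open>d\<close> contains a face of dimension \<open>d\<close>.\<close>
  have dim': "complex_dim K' = d" if ne: "?X' \<noteq> {}"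
  proof (rule antisym)
    obtain E where E: "E \<in> ?X'" "?n' E = complex_dim K'"
      using K'.complex_dim_attained[OF ne] by blast
    have "(\<sigma> E, \<sigma> E) \<in> K" using \<sigma> E(1) le_refl faces_in_Field by blast
    then show "complex_dim K' \<le> d"
      using dim_le[OF \<sigma>[OF E(1)] E(1)] dim_d[OF \<sigma>[OF E(1)]] E(2) by simp
    have "?X \<noteq> {}" using \<sigma>[OF E(1)] by blast
    then obtain H where H: "H \<in> ?X" "?n H = d"
      using complex_dim_attained assms(3) by metis
    then show "d \<le> complex_dim K'"
      using dim_eq[OF H(1)] K'.face_dim_le_complex_dim[OF K'.faces_in_Field] by metis
  qed

  \<comment> \<open>Inverting the link polynomials: the interval \<open>[G, H]\<close> contributes \<open>(x - 1) ^ (dim H - dim G)\<close>.\<close>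
  have link: "(\<Sum>F\<in>{F \<in> ?X. (G, F) \<in> K}. (-1) ^ nat (?n F - ?n G) * h_link d K F) =
      q ^ nat (d - ?n G) * (\<Sum>H\<in>{H \<in> ?X. (G, H) \<in> K}. (-1) ^ nat (?n H - ?n G))"
    if G: "G \<in> ?X" for G
  proof -
    let ?U = "{F \<in> ?X. (G, F) \<in> K}"
    let ?t = "\<lambda>F H. (-1) ^ nat (?n F - ?n G) * (x ^ nat (?n H - ?n F) * q ^ nat (d - ?n H))"
    have fin: "finite ?U" using finite_faces by simp
    have "(\<Sum>F\<in>?U. (-1) ^ nat (?n F - ?n G) * h_link d K F) =
        (\<Sum>F\<in>?U. \<Sum>H\<in>{H. H \<in> ?U \<and> (F, H) \<in> K}. ?t F H)"
    proof (rule sum.cong[OF refl])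
      fix F assume F: "F \<in> ?U"
      have "{H \<in> Field K. (F, H) \<in> K} = {H. H \<in> ?U \<and> (F, H) \<in> K}"
        using F faces_above faces_in_Field le_trans by blast
      then show "(-1) ^ nat (?n F - ?n G) * h_link d K F = (\<Sum>H\<in>{H. H \<in> ?U \<and> (F, H) \<in> K}. ?t F H)"
        by (simp add: h_link_def sum_distrib_left x_def q_def)
    qed
    also have "\<dots> = (\<Sum>H\<in>?U. \<Sum>F\<in>{F. F \<in> ?U \<and> (F, H) \<in> K}. ?t F H)"
      by (rule sum.swap_restrict[OF fin fin])
    also have "\<dots> = (\<Sum>H\<in>?U. q ^ nat (d - ?n G) * (-1) ^ nat (?n H - ?n G))"
    proof (rule sum.cong[OF refl])
      fix H assume "H \<in> ?U"
      then have H: "H \<in> ?X" "(G, H) \<in> K" by auto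
      have set: "{F. F \<in> ?U \<and> (F, H) \<in> K} = {F \<in> ?X. (G, F) \<in> K \<and> (F, H) \<in> K}" by auto
      \<comment> \<open>Since \<open>x - 1\<close> is the negative of \<open>q = 1 - x\<close>, the
        interval sum merges with \<open>q ^ (d - dim H)\<close> into a power of \<open>q\<close>
        that does not depend on \<open>H\<close>.\<close>
      have xq: "-1 + x = (-1) * q" by (simp add: x_def q_def one_pCons)
      have "(\<Sum>F\<in>{F. F \<in> ?U \<and> (F, H) \<in> K}. ?t F H) = 
          (\<Sum>F\<in>{F \<in> ?X. (G, F) \<in> K \<and> (F, H) \<in> K}. (-1) ^ nat (?n F - ?n G) * x ^ nat (?n H - ?n F))
            * q ^ nat (d - ?n H)"
        unfolding set by (simp add: sum_distrib_right mult.assoc)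
      also have "\<dots> = ((-1) * q) ^ nat (?n H - ?n G) * q ^ nat (d - ?n H)"
        unfolding sum_interval[OF G H(2)] xq ..
      also have "\<dots> = (-1) ^ nat (?n H - ?n G) * q ^ (nat (?n H - ?n G) + nat (d - ?n H))"
        by (simp only: power_mult_distrib power_add mult.assoc)
      also have "nat (?n H - ?n G) + nat (d - ?n H) = nat (d - ?n G)"
        using face_dim_mono[OF G H(2)] dim_d[OF H(1)] by simp
      finally show "(\<Sum>F\<in>{F. F \<in> ?U \<and> (F, H) \<in> K}. ?t F H) = q ^ nat (d - ?n G) * (-1) ^ nat (?n H - ?n G)"
        by (simp only: mult.commute)
    qed
    finally show ?thesis by (simp only: sum_distrib_left)
  qed

  \<comment> \<open>After the sums are exchanged, each inner sum runs over all \<open>G\<close> in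
    the interval from \<open>F\<close> to \<open>H\<close> and equals
    \<open>(1 - 1) ^ (dim H - dim F)\<close>, so only \<open>H = F\<close> contributes.\<close>
  have alt: "(\<Sum>G\<in>{G \<in> ?X. (F, G) \<in> K}. \<Sum>H\<in>{H \<in> ?X. (G, H) \<in> K}. (-1) ^ nat (?n H - ?n G)) = (1::int poly)"
    if F: "F \<in> ?X" for F
  proof -
    let ?U = "{G \<in> ?X. (F, G) \<in> K}"
    have fin: "finite ?U" using finite_faces by simp
    have FF: "(F, F) \<in> K" using F le_refl faces_in_Field by blast
    have "(\<Sum>G\<in>?U. \<Sum>H\<in>{H \<in> ?X. (G, H) \<in> K}. (-1) ^ nat (?n H - ?n G)) =
        (\<Sum>G\<in>?U. \<Sum>H\<in>{H. H \<in> ?U \<and> (G, H) \<in> K}. (-1::int poly) ^ nat (?n H - ?n G))"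
      by (intro sum.cong refl) (use le_trans in blast)
    also have "\<dots> = (\<Sum>H\<in>?U. \<Sum>G\<in>{G. G \<in> ?U \<and> (G, H) \<in> K}. (-1) ^ nat (?n H - ?n G))"
      by (rule sum.swap_restrict[OF fin fin])
    also have "\<dots> = (\<Sum>H\<in>?U. if H = F then 1 else 0)"
    proof (rule sum.cong[OF refl])
      fix H assume "H \<in> ?U"
      then have H: "H \<in> ?X" "(F, H) \<in> K" by auto
      have set: "{G. G \<in> ?U \<and> (G, H) \<in> K} = {G \<in> ?X. (F, G) \<in> K \<and> (G, H) \<in> K}" by auto
      have "(\<Sum>G\<in>{G. G \<in> ?U \<and> (G, H) \<in> K}. (-1::int poly) ^ nat (?n H - ?n G)) =
          (1 + -1) ^ nat (?n H - ?n F)"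
        unfolding set sum_interval[OF F H(2), symmetric] by simp
      also have "\<dots> = (if H = F then 1 else 0)"
        using face_dim_mono[OF F H(2)] face_dim_eq_imp_eq[OF F H(2)] by (auto simp: power_0_left)
      finally show "(\<Sum>G\<in>{G. G \<in> ?U \<and> (G, H) \<in> K}. (-1::int poly) ^ nat (?n H - ?n G)) =
          (if H = F then 1 else 0)" .
    qed
    also have "\<dots> = 1" using F FF fin by (simp add: sum.delta)
    finally show ?thesis .
  qed

  let ?a = "\<lambda>G. \<Sum>H\<in>{H \<in> ?X. (G, H) \<in> K}. (-1::int poly) ^ nat (?n H - ?n G)"
  have "(\<Sum>F\<in>?X. local_h K K' \<sigma> F * h_link d K F) =
      (\<Sum>F\<in>?X. \<Sum>G\<in>{G. G \<in> ?X \<and> (G, F) \<in> K}.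
        h_sc (restriction K K' \<sigma> G) * ((-1) ^ nat (?n F - ?n G) * h_link d K F))"
    unfolding local_h_def sum_distrib_right by (intro sum.cong refl) (simp only: mult_ac)
  also have "\<dots> = (\<Sum>G\<in>?X. \<Sum>F\<in>{F. F \<in> ?X \<and> (G, F) \<in> K}.
        h_sc (restriction K K' \<sigma> G) * ((-1) ^ nat (?n F - ?n G) * h_link d K F))"
    by (rule sum.swap_restrict[OF finite_faces finite_faces])
  also have "\<dots> = (\<Sum>G\<in>?X. h_sc (restriction K K' \<sigma> G) * (q ^ nat (d - ?n G) * ?a G))"
    by (intro sum.cong refl) (simp only: sum_distrib_left[symmetric] link)
  also have "\<dots> = (\<Sum>G\<in>?X. \<Sum>E\<in>{E. E \<in> ?X' \<and> (\<sigma> E, G) \<in> K}. y ^ nat (?n' E) * q ^ nat (d - ?n' E) * ?a G)"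
  proof (rule sum.cong[OF refl])
    fix G assume G: "G \<in> ?X"
    have "y ^ nat (?n' E) * q ^ nat (?n G - ?n' E) * (q ^ nat (d - ?n G) * ?a G) =
        y ^ nat (?n' E) * q ^ nat (d - ?n' E) * ?a G" if "E \<in> ?X'" "(\<sigma> E, G) \<in> K" for E
    proof -
      \<comment> \<open>The bounds \<open>dim E \<le> dim G \<le> d\<close> make both differences
        nonnegative, so \<open>nat\<close> truncates nothing and the exponents add.\<close>
      have "nat (d - ?n' E) = nat (?n G - ?n' E) + nat (d - ?n G)"
        using dim_le[OF G that] dim_d[OF G] by simp
      then show ?thesis by (simp only: power_add mult.assoc)
    qed
    then show "h_sc (restriction K K' \<sigma> G) * (q ^ nat (d - ?n G) * ?a G) =
        (\<Sum>E\<in>{E. E \<in> ?X' \<and> (\<sigma> E, G) \<in> K}. y ^ nat (?n' E) * q ^ nat (d - ?n' E) * ?a G)"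
      unfolding h_restr[OF G] sum_distrib_right by (intro sum.cong refl) blast
  qed
  \<comment> \<open>With \<open>E\<close> outermost, the factor before \<open>?a G\<close> is
    constant in \<open>G\<close>, and the remaining double sum is \<open>alt\<close> at the carrier
    \<open>\<sigma> E\<close>.\<close>
  also have "\<dots> = (\<Sum>E\<in>?X'. \<Sum>G\<in>{G. G \<in> ?X \<and> (\<sigma> E, G) \<in> K}. y ^ nat (?n' E) * q ^ nat (d - ?n' E) * ?a G)"
    by (rule sum.swap_restrict[OF finite_faces K'.finite_faces])
  also have "\<dots> = (\<Sum>E\<in>?X'. y ^ nat (?n' E) * q ^ nat (d - ?n' E))"
    by (intro sum.cong refl) (simp only: sum_distrib_left[symmetric] alt[OF \<sigma>] mult_1_right)
  also have "\<dots> = h_sc K'"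
    \<comment> \<open>If \<open>K'\<close> has no nonempty face, both sides are empty sums.\<close>
    using dim' by (cases "?X' = {}") (simp_all add: h_sc_def y_def q_def)
  finally show ?thesis by simp
qed

end
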